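(* The polynomials $f_4$, $-f_3$, $f_2$ have the form $$f_4(s)=\tfrac1{4!}s(s-1)(s-3)(s-r_4),\qquad -f_3(s)=\tfrac1{3!}s(s-1)(s-r_3),\qquad f_2(s)=\tfrac1{2!}s(s-r_2),$$ where the roots $r_4,r_3,r_2$ are, respectively, the complex dimensions of the simple Lie algebras of type $G_2$, $A_2$ and $A_1$, namely $14$, $8$ and $3$, so that $$f_4(s)=\tfrac1{4!}s(s-1)(s-3)(s-14),\qquad -f_3(s)=\tfrac1{3!}s(s-1)(s-8),\qquad f_2(s)=\tfrac1{2!}s(s-3).$$
   Context: For $s\in\mathbb C$ the power $\left(\prod_{n=1}^\infty(1-x^n)\right)^s$ is the formal power series in $x$ obtained by taking the logarithm of the Euler product, multiplying by $s$, and exponentiating. Then $\left(\prod_{n=1}^\infty(1-x^n)\right)^s=\sum_{k=0}^\infty f_k(s)x^k$, where $f_k(s)$ is a polynomial in $s$ of degree $k$. *)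

theory Defs
  imports
    "HOL-Analysis.Analysis"
    "HOL-Library.Function_Algebras"
    "HOL-Computational_Algebra.Formal_Power_Series"
begin

section \<open>Complex powers of the Euler product\<close>

text \<open>The infinite product is taken in the metric (X-adic) topology on formal power series.\<close>

definition euler_product :: "complex fps" where
  "euler_product = (\<Prod>n. 1 - fps_X ^ Suc n)"

text \<open>\<^term>\<open>fps_ln 1\<close> is the series of \<open>log (1 + X)\<close>, so it is composed with \<open>F - 1\<close>;
  meaningful for \<open>F\<close> with constant coefficient 1.\<close>

definition formal_log :: "complex fps \<Rightarrow> complex fps" where
  "formal_log F = fps_compose (fps_ln 1) (F - 1)"

definition formal_power :: "complex fps \<Rightarrow> complex \<Rightarrow> complex fps" where
  "formal_power F s = fps_compose (fps_exp 1) (fps_const s * formal_log F)"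

definition euler_coeff :: "nat \<Rightarrow> complex \<Rightarrow> complex" where
  "euler_coeff k s = fps_nth (formal_power euler_product s) k"


section \<open>Complex Lie algebras\<close>

text \<open>A Lie algebra is a subspace \<open>L\<close> of some ambient complex vector space, with a bracket whose
  values outside \<open>L\<close> are irrelevant.\<close>

locale complex_lie_algebra = vector_space scale
  for scale :: "complex \<Rightarrow> 'a::ab_group_add \<Rightarrow> 'a" +
  fixes L :: "'a set" and br :: "'a \<Rightarrow> 'a \<Rightarrow> 'a"
  assumes subspace_L: "subspace L"
    and br_closed: "x \<in> L \<Longrightarrow> y \<in> L \<Longrightarrow> br x y \<in> L"
    and br_add_left: "x \<in> L \<Longrightarrow> y \<in> L \<Longrightarrow> z \<in> L \<Longrightarrow> br (x + y) z = br x z + br y z"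
    and br_add_right: "x \<in> L \<Longrightarrow> y \<in> L \<Longrightarrow> z \<in> L \<Longrightarrow> br x (y + z) = br x y + br x z"
    and br_scale_left: "x \<in> L \<Longrightarrow> y \<in> L \<Longrightarrow> br (scale c x) y = scale c (br x y)"
    and br_scale_right: "x \<in> L \<Longrightarrow> y \<in> L \<Longrightarrow> br x (scale c y) = scale c (br x y)"
    and br_self: "x \<in> L \<Longrightarrow> br x x = 0"
    and jacobi: "x \<in> L \<Longrightarrow> y \<in> L \<Longrightarrow> z \<in> L \<Longrightarrow>
      br x (br y z) + br y (br z x) + br z (br x y) = 0"
begin

definition finite_dim :: bool where
  "finite_dim \<longleftrightarrow> (\<exists>B. finite B \<and> L = span B)"

definition ideal :: "'a set \<Rightarrow> bool" where
  "ideal I \<longleftrightarrow> subspace I \<and> I \<subseteq> L \<and> (\<forall>x\<in>L. \<forall>y\<in>I. br x y \<in> I)"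

definition simple :: bool where
  "simple \<longleftrightarrow> (\<exists>x\<in>L. \<exists>y\<in>L. br x y \<noteq> 0) \<and> (\<forall>I. ideal I \<longrightarrow> I = {0} \<or> I = L)"

definition ad_diagonalizable :: "'a \<Rightarrow> bool" where
  "ad_diagonalizable h \<longleftrightarrow> L = span {x \<in> L. \<exists>c. br h x = scale c x}"

text \<open>The usual notion for complex semisimple Lie algebras: a maximal abelian subalgebra all of
  whose elements are ad-diagonalizable.\<close>

definition cartan_subalgebra :: "'a set \<Rightarrow> bool" where
  "cartan_subalgebra H \<longleftrightarrow> subspace H \<and> H \<subseteq> L
     \<and> (\<forall>h\<in>H. \<forall>h'\<in>H. br h h' = 0)
     \<and> (\<forall>x\<in>L. (\<forall>h\<in>H. br h x = 0) \<longrightarrow> x \<in> H)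
     \<and> (\<forall>h\<in>H. ad_diagonalizable h)"

text \<open>Elements of the dual of \<open>H\<close> are represented by functions on the whole type, of which only
  the values on \<open>H\<close> matter.  Linearity on \<open>H\<close> is automatic once the root space is nonzero.\<close>

definition root_space :: "'a set \<Rightarrow> ('a \<Rightarrow> complex) \<Rightarrow> 'a set" where
  "root_space H \<alpha> = {x \<in> L. \<forall>h\<in>H. br h x = scale (\<alpha> h) x}"

definition is_root :: "'a set \<Rightarrow> ('a \<Rightarrow> complex) \<Rightarrow> bool" where
  "is_root H \<alpha> \<longleftrightarrow> (\<exists>h\<in>H. \<alpha> h \<noteq> 0) \<and> root_space H \<alpha> \<noteq> {0}"

definition is_base :: "'a set \<Rightarrow> nat \<Rightarrow> (nat \<Rightarrow> 'a \<Rightarrow> complex) \<Rightarrow> bool" where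
  "is_base H n \<alpha> \<longleftrightarrow>
     (\<forall>i<n. is_root H (\<alpha> i))
     \<and> (\<forall>c :: nat \<Rightarrow> complex. (\<forall>h\<in>H. (\<Sum>i<n. c i * \<alpha> i h) = 0) \<longrightarrow> (\<forall>i<n. c i = 0))
     \<and> (\<forall>\<beta>. is_root H \<beta> \<longrightarrow> (\<exists>c :: nat \<Rightarrow> nat.
            (\<forall>h\<in>H. \<beta> h = (\<Sum>i<n. of_nat (c i) * \<alpha> i h))
          \<or> (\<forall>h\<in>H. \<beta> h = - (\<Sum>i<n. of_nat (c i) * \<alpha> i h))))"

definition is_coroot :: "'a set \<Rightarrow> ('a \<Rightarrow> complex) \<Rightarrow> 'a \<Rightarrow> bool" where
  "is_coroot H \<alpha> h \<longleftrightarrow>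
     (\<exists>x \<in> root_space H \<alpha>. \<exists>y \<in> root_space H (\<lambda>k. - \<alpha> k). h = br x y) \<and> \<alpha> h = 2"

definition has_cartan_matrix :: "nat \<Rightarrow> (nat \<Rightarrow> nat \<Rightarrow> int) \<Rightarrow> bool" where
  "has_cartan_matrix n A \<longleftrightarrow> (\<exists>H \<alpha> h. cartan_subalgebra H \<and> is_base H n \<alpha>
     \<and> (\<forall>i<n. is_coroot H (\<alpha> i) (h i))
     \<and> (\<forall>i<n. \<forall>j<n. \<alpha> j (h i) = of_int (A i j)))"

end

text \<open>Only the Dynkin types needed here.  Indices run over \<open>{..<n}\<close> for rank \<open>n\<close>.\<close>

datatype dynkin_type = Type_A nat | Type_G2

fun dynkin_rank :: "dynkin_type \<Rightarrow> nat" where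
  "dynkin_rank (Type_A n) = n"
| "dynkin_rank Type_G2 = 2"

fun cartan_matrix :: "dynkin_type \<Rightarrow> nat \<Rightarrow> nat \<Rightarrow> int" where
  "cartan_matrix (Type_A n) i j = (if i = j then 2 else if i = Suc j \<or> j = Suc i then -1 else 0)"
| "cartan_matrix Type_G2 i j = (if i = j then 2 else if i < j then -1 else -3)"

definition simple_lie_algebra_of_type ::
  "dynkin_type \<Rightarrow> (complex \<Rightarrow> 'a::ab_group_add \<Rightarrow> 'a) \<Rightarrow> 'a set \<Rightarrow> ('a \<Rightarrow> 'a \<Rightarrow> 'a) \<Rightarrow> bool" where
  "simple_lie_algebra_of_type T sc L br \<longleftrightarrow>
     complex_lie_algebra sc L br
     \<and> complex_lie_algebra.finite_dim sc L
     \<and> complex_lie_algebra.simple sc L br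
     \<and> complex_lie_algebra.has_cartan_matrix sc L br (dynkin_rank T) (cartan_matrix T)"

text \<open>Every finite-dimensional complex vector space embeds into the following one, so it can host
  any finite-dimensional Lie algebra.\<close>

definition seq_scale :: "complex \<Rightarrow> (nat \<Rightarrow> complex) \<Rightarrow> (nat \<Rightarrow> complex)" where
  "seq_scale c f = (\<lambda>n. c * f n)"

end

theory Submission
  imports Defs
begin

text \<open>
  The Euler product has logarithm \<open>- (\<Sum>k\<ge>1. \<sigma>(k)/k * x^k)\<close>, where \<open>\<sigma>(k)\<close> is the sum of the divisors of
  \<open>k\<close>; its first coefficients are \<open>-1, -3/2, -4/3, -7/4\<close>.  Multiplying by \<open>s\<close> and composing with the
  exponential series gives the three polynomials in factored form (\<open>euler_coeff_values\<close>).  What remains is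
  to see that the roots \<open>14, 8, 3\<close> are dimensions of Lie algebras: such Lie algebras exist, and the
  Cartan matrix determines their dimension.

  Dimension.  Let \<open>L\<close> be simple with Cartan subalgebra \<open>H\<close> and base \<open>\<alpha>\<close>.  Commuting diagonalisable
  operators are simultaneously diagonalisable, so \<open>L\<close> is the sum of \<open>H\<close> and its root spaces
  (\<open>root_space_decomposition\<close>).  Each simple root \<open>\<alpha>\<close> comes with an sl(2)-triple \<open>e, f, h\<close>, and
  everything else follows from one fact about sl(2): on vectors of weight \<open>m \<ge> 0\<close> the powers \<open>f^j\<close>
  with \<open>j \<le> m\<close> are injective (\<open>sl2_lowering_injective\<close>).  It shows that the root space of \<open>\<alpha>\<close> is a line,
  that \<open>2\<alpha>, 3\<alpha>, \<dots>\<close> are not roots, and that \<open>f^m\<close> identifies the root spaces of \<open>\<beta>\<close> and of its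
  reflection \<open>\<beta> - m\<alpha>\<close>.  Write a root as \<open>a\<alpha>\<^sub>1 + b\<alpha>\<^sub>2\<close>.  The coefficients \<open>a\<close> and \<open>b\<close> and those of
  every reflection have the same sign, and unless one of them vanishes, some simple reflection makes one
  of them smaller in absolute value.  Hence every root is reached from a multiple of a simple root by
  reflections; this leaves 2, 6 and 12 roots for A1, A2 and G2, each with a one-dimensional root space.
  As simplicity makes \<open>H\<close> have a basis of coroots, the dimension is the rank plus the number
  of roots: \<open>1 + 2 = 3\<close>, \<open>2 + 6 = 8\<close>, \<open>2 + 12 = 14\<close>.

  Existence.  G2 is realised on \<open>sl(3) \<oplus> V \<oplus> V*\<close> with \<open>V\<close> the three-dimensional representation of sl(3).
  The Jacobi identity is a polynomial identity in coordinates.  The six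
  roots of sl(3) span A2 inside it, and one opposite pair of these spans A1, so a single bracket and a
  single verification serve the three types.  Simplicity holds because a nonzero ideal contains a root vector,
  and from any root vector one reaches all the others by brackets.
\<close>

section \<open>Coefficients of the powers of the Euler product\<close>

lemma euler_partial_product_Suc_nth:
  "fps_nth (\<Prod>i\<le>Suc n. 1 - fps_X ^ Suc i :: complex fps) k
     = fps_nth (\<Prod>i\<le>n. 1 - fps_X ^ Suc i) k
       - (if k < n + 2 then 0 else fps_nth (\<Prod>i\<le>n. 1 - fps_X ^ Suc i) (k - (n + 2)))"
proof -
  let ?P = "\<Prod>i\<le>n. 1 - fps_X ^ Suc i :: complex fps"
  have "(\<Prod>i\<le>Suc n. 1 - fps_X ^ Suc i) = ?P - fps_X ^ (n + 2) * ?P"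
    unfolding prod.atMost_Suc by (simp add: algebra_simps del: power_Suc)
  then show ?thesis by (simp only: fps_sub_nth fps_X_power_mult_nth)
qed

text \<open>The factors \<open>1 - x^i\<close> with \<open>i > k\<close> do not affect the coefficient of \<open>x^k\<close>.\<close>

lemma euler_partial_product_stable:
  assumes "k \<le> n"
  shows "fps_nth (\<Prod>i\<le>n. 1 - fps_X ^ Suc i) k = fps_nth (\<Prod>i\<le>k. 1 - fps_X ^ Suc i :: complex fps) k"
  using assms
proof (induction n rule: dec_induct)
  case (step n)
  then have "k < n + 2" by simp
  then show ?case unfolding euler_partial_product_Suc_nth step.IH by (simp only: if_True diff_zero)
qed (rule refl)

text \<open>The coefficients of the partial products are eventually constant, which is convergence in the X-adic
  topology.\<close>

lemma euler_product_nth: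
  "fps_nth euler_product k = fps_nth (\<Prod>i\<le>k. 1 - fps_X ^ Suc i :: complex fps) k"
proof -
  define F where "F = Abs_fps (\<lambda>k. fps_nth (\<Prod>i\<le>k. 1 - fps_X ^ Suc i :: complex fps) k)"
  have "(\<lambda>n. \<Prod>i\<le>n. 1 - fps_X ^ Suc i) \<longlonglongrightarrow> F"
  proof (rule tendsto_fpsI)
    fix k
    show "\<forall>\<^sub>F n in sequentially. fps_nth (\<Prod>i\<le>n. 1 - fps_X ^ Suc i) k = fps_nth F k"
      using eventually_ge_at_top[of k]
      by eventually_elim (simp only: F_def fps_nth_Abs_fps, rule euler_partial_product_stable)
  qed
  \<comment> \<open>A nonzero limit is part of the definition of a convergent infinite product.\<close>
  moreover have "F \<noteq> 0"
  proof
    assume "F = 0"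
    then have "fps_nth F 0 = 0" by simp
    then show False by (simp add: F_def)
  qed
  ultimately have "(\<lambda>n. 1 - fps_X ^ Suc n) has_prod F"
    unfolding has_prod_def raw_has_prod_def add_0_right by (intro disjI1 conjI)
  then have "euler_product = F" unfolding euler_product_def by (rule has_prod_unique[symmetric])
  show ?thesis unfolding \<open>euler_product = F\<close> unfolding F_def by (rule fps_nth_Abs_fps)
qed

lemma euler_product_coeffs:
  "fps_nth euler_product 0 = 1" "fps_nth euler_product 1 = -1" "fps_nth euler_product 2 = -1"
  "fps_nth euler_product 3 = 0" "fps_nth euler_product 4 = 0"
proof -
  have p0: "fps_nth (\<Prod>i\<le>0. 1 - fps_X ^ Suc i :: complex fps) k = (if k = 0 then 1 else if k = 1 then -1 else 0)" for k
    by simp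
  note step = euler_partial_product_Suc_nth
  have p1: "fps_nth (\<Prod>i\<le>Suc 0. 1 - fps_X ^ Suc i :: complex fps) k
      = (if k = 0 then 1 else if k = 1 \<or> k = 2 then -1 else if k = 3 then 1 else 0)" for k
    unfolding step p0 by auto
  have p2: "fps_nth (\<Prod>i\<le>Suc (Suc 0). 1 - fps_X ^ Suc i :: complex fps) k
      = (if k = 0 then 1 else if k = 1 \<or> k = 2 then -1 else if k = 4 \<or> k = 5 then 1
         else if k = 6 then -1 else 0)" for k
    unfolding step[of "Suc 0"] p1 by auto
  show "fps_nth euler_product 0 = 1" unfolding euler_product_nth p0 by simp
  show "fps_nth euler_product 1 = -1" unfolding euler_product_nth One_nat_def p1 by simp
  have "fps_nth euler_product (Suc (Suc 0)) = -1" unfolding euler_product_nth p2 by simp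
  then show "fps_nth euler_product 2 = -1" by (simp add: numeral_eq_Suc)
  have "fps_nth euler_product (Suc (Suc (Suc 0))) = 0" unfolding euler_product_nth step[of "Suc (Suc 0)"] p2 by simp
  then show "fps_nth euler_product 3 = 0" by (simp add: numeral_eq_Suc)
  have "fps_nth euler_product (Suc (Suc (Suc (Suc 0)))) = 0"
    unfolding euler_product_nth step[of "Suc (Suc (Suc 0))"] step[of "Suc (Suc 0)"] p2 by simp
  then show "fps_nth euler_product 4 = 0" by (simp add: numeral_eq_Suc)
qed

text \<open>The coefficient of \<open>x^k\<close> in a composition is a sum over the compositions of \<open>k\<close> into positive parts;
  up to \<open>k = 4\<close> this is short enough to be written out.\<close>

lemma fps_compose_low_coeffs:
  fixes a b :: "'a::comm_ring_1 fps"
  assumes b0: "fps_nth b 0 = 0"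
  shows "fps_nth (a oo b) 1 = fps_nth a 1 * fps_nth b 1"
    "fps_nth (a oo b) 2 = fps_nth a 1 * fps_nth b 2 + fps_nth a 2 * fps_nth b 1 ^ 2"
    "fps_nth (a oo b) 3 = fps_nth a 1 * fps_nth b 3 + 2 * fps_nth a 2 * fps_nth b 1 * fps_nth b 2
       + fps_nth a 3 * fps_nth b 1 ^ 3"
    "fps_nth (a oo b) 4 = fps_nth a 1 * fps_nth b 4
       + fps_nth a 2 * (2 * fps_nth b 1 * fps_nth b 3 + fps_nth b 2 ^ 2)
       + 3 * fps_nth a 3 * fps_nth b 1 ^ 2 * fps_nth b 2 + fps_nth a 4 * fps_nth b 1 ^ 4"
proof -
  note expand = fps_mult_nth sum.atLeast0_atMost_Suc numeral_eq_Suc b0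
  have p2: "fps_nth (b ^ 2) 0 = 0" "fps_nth (b ^ 2) 1 = 0" "fps_nth (b ^ 2) 2 = fps_nth b 1 ^ 2"
    "fps_nth (b ^ 2) 3 = 2 * fps_nth b 1 * fps_nth b 2"
    "fps_nth (b ^ 2) 4 = 2 * fps_nth b 1 * fps_nth b 3 + fps_nth b 2 ^ 2"
    unfolding power2_eq_square by (simp_all add: expand algebra_simps)
  have b3: "b ^ 3 = b ^ 2 * b" and b4: "b ^ 4 = b ^ 2 * b ^ 2"
    by (simp_all add: eval_nat_numeral algebra_simps)
  have p3: "fps_nth (b ^ 3) 0 = 0" "fps_nth (b ^ 3) 1 = 0" "fps_nth (b ^ 3) 2 = 0"
    "fps_nth (b ^ 3) 3 = fps_nth b 1 ^ 3" "fps_nth (b ^ 3) 4 = 3 * fps_nth b 1 ^ 2 * fps_nth b 2"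
    unfolding b3 using p2 by (simp_all add: expand algebra_simps)
  have p4: "fps_nth (b ^ 4) 0 = 0" "fps_nth (b ^ 4) 1 = 0" "fps_nth (b ^ 4) 2 = 0"
    "fps_nth (b ^ 4) 3 = 0" "fps_nth (b ^ 4) 4 = fps_nth b 1 ^ 4"
    unfolding b4 using p2 by (simp_all add: expand algebra_simps)
  have up: "{0..1::nat} = {0, 1}" "{0..2::nat} = {0, 1, 2}" "{0..3::nat} = {0, 1, 2, 3}"
    "{0..4::nat} = {0, 1, 2, 3, 4}"
    by auto
  show "fps_nth (a oo b) 1 = fps_nth a 1 * fps_nth b 1"
    "fps_nth (a oo b) 2 = fps_nth a 1 * fps_nth b 2 + fps_nth a 2 * fps_nth b 1 ^ 2"
    "fps_nth (a oo b) 3 = fps_nth a 1 * fps_nth b 3 + 2 * fps_nth a 2 * fps_nth b 1 * fps_nth b 2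
       + fps_nth a 3 * fps_nth b 1 ^ 3"
    "fps_nth (a oo b) 4 = fps_nth a 1 * fps_nth b 4
       + fps_nth a 2 * (2 * fps_nth b 1 * fps_nth b 3 + fps_nth b 2 ^ 2)
       + 3 * fps_nth a 3 * fps_nth b 1 ^ 2 * fps_nth b 2 + fps_nth a 4 * fps_nth b 1 ^ 4"
    unfolding fps_compose_nth up using p2 p3 p4 by (simp_all add: algebra_simps)
qed

text \<open>The coefficient of \<open>x^k\<close> is \<open>- \<sigma>(k)/k\<close>.\<close>

lemma formal_log_euler_coeffs:
  "fps_nth (formal_log euler_product) 0 = 0" "fps_nth (formal_log euler_product) 1 = -1"
  "fps_nth (formal_log euler_product) 2 = -3/2" "fps_nth (formal_log euler_product) 3 = -4/3"
  "fps_nth (formal_log euler_product) 4 = -7/4"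
proof -
  have "fps_nth (euler_product - 1) 0 = 0" using euler_product_coeffs by simp
  note c = fps_compose_low_coeffs[OF this]
  show "fps_nth (formal_log euler_product) 0 = 0"
    unfolding formal_log_def by (simp add: fps_ln_def)
  show "fps_nth (formal_log euler_product) 1 = -1"
    "fps_nth (formal_log euler_product) 2 = -3/2" "fps_nth (formal_log euler_product) 3 = -4/3"
    "fps_nth (formal_log euler_product) 4 = -7/4"
    unfolding formal_log_def c
    using euler_product_coeffs by (simp_all add: fps_ln_nth)
qed

lemma euler_coeff_values:
  "euler_coeff 2 s = 1 / fact 2 * s * (s - 3)"
  "- euler_coeff 3 s = 1 / fact 3 * s * (s - 1) * (s - 8)"
  "euler_coeff 4 s = 1 / fact 4 * s * (s - 1) * (s - 3) * (s - 14)"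
proof -
  have "fps_nth (fps_const s * formal_log euler_product) 0 = 0"
    by (simp add: formal_log_euler_coeffs)
  note c = fps_compose_low_coeffs[OF this]
  have facts: "fact 2 = (2::complex)" "fact 3 = (6::complex)" "fact 4 = (24::complex)"
    by (simp_all add: fact_numeral)
  show "euler_coeff 2 s = 1 / fact 2 * s * (s - 3)"
    "- euler_coeff 3 s = 1 / fact 3 * s * (s - 1) * (s - 8)"
    "euler_coeff 4 s = 1 / fact 4 * s * (s - 1) * (s - 3) * (s - 14)"
    unfolding euler_coeff_def formal_power_def c fps_mult_left_const_nth formal_log_euler_coeffs
      fps_exp_nth facts
    by (simp_all add: field_simps eval_nat_numeral)
qed

section \<open>Weight vectors and root space decomposition\<close>

text \<open>An element of a span of subspaces is a sum with at most one term from each of them; the terms of a linear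
  combination have to be grouped by a choice of subspace.\<close>

lemma (in vector_space) span_Union_sum:
  assumes "\<And>i. subspace (U i)" and "x \<in> span (\<Union>i. U i)"
  obtains F v where "finite F" "\<And>i. i \<in> F \<Longrightarrow> v i \<in> U i" "x = (\<Sum>i\<in>F. v i)"
proof -
  from assms(2) obtain T r where T: "finite T" "T \<subseteq> (\<Union>i. U i)" "x = (\<Sum>a\<in>T. scale (r a) a)"
    unfolding span_explicit by auto
  from T(2) have "\<forall>a\<in>T. \<exists>i. a \<in> U i" by auto
  then obtain c where c: "\<And>a. a \<in> T \<Longrightarrow> a \<in> U (c a)" by metis
  show ?thesis
  proof (rule that[of "c ` T" "\<lambda>i. \<Sum>a\<in>{a \<in> T. c a = i}. scale (r a) a"])
    show "(\<Sum>a\<in>{a \<in> T. c a = i}. scale (r a) a) \<in> U i" for i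
      using c by (intro subspace_sum[OF assms(1)] subspace_scale[OF assms(1)]) auto
    show "x = (\<Sum>i\<in>c ` T. \<Sum>a\<in>{a \<in> T. c a = i}. scale (r a) a)"
      unfolding T(3) using T(1) by (rule sum.image_gen)
  qed (use T in auto)
qed

context complex_lie_algebra
begin

lemma zero_in_L: "0 \<in> L"
  using subspace_L by (rule subspace_0)

lemma br_zero_right: "x \<in> L \<Longrightarrow> br x 0 = 0"
  using br_scale_right[of x 0 0] zero_in_L by simp

lemma br_zero_left: "x \<in> L \<Longrightarrow> br 0 x = 0"
  using br_scale_left[of 0 x 0] zero_in_L by simp

lemma br_minus_right: "x \<in> L \<Longrightarrow> y \<in> L \<Longrightarrow> br x (- y) = - br x y"
  using br_scale_right[of x y "-1"] by simp

lemma br_diff_right: "x \<in> L \<Longrightarrow> y \<in> L \<Longrightarrow> z \<in> L \<Longrightarrow> br x (y - z) = br x y - br x z"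
  using br_add_right[of x y "- z"] br_minus_right[of x z] subspace_neg[OF subspace_L] by simp

lemma br_sum_right:
  assumes "x \<in> L" and "\<And>i. i \<in> F \<Longrightarrow> v i \<in> L"
  shows "br x (\<Sum>i\<in>F. v i) = (\<Sum>i\<in>F. br x (v i))"
  using assms(2)
proof (induction F rule: infinite_finite_induct)
  case (insert i F)
  then have "(\<Sum>i\<in>F. v i) \<in> L" by (intro subspace_sum[OF subspace_L]) auto
  with insert assms(1) show ?case by (simp add: br_add_right)
qed (simp_all add: br_zero_right assms(1))

lemma br_antisym:
  assumes "x \<in> L" "y \<in> L"
  shows "br x y = - br y x"
proof -
  have xy: "x + y \<in> L" using assms subspace_add[OF subspace_L] by blast
  have "br (x + y) (x + y) = 0" using xy by (rule br_self)
  moreover have "br (x + y) (x + y) = br x y + br y x"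
    using assms xy br_add_left[of x y "x + y"] by (simp add: br_add_right br_self)
  ultimately show ?thesis by (simp add: eq_neg_iff_add_eq_0)
qed

text \<open>The Jacobi identity in the form in which it is used: bracketing with \<open>x\<close> is a derivation.\<close>

lemma br_derivation:
  assumes "x \<in> L" "y \<in> L" "z \<in> L"
  shows "br x (br y z) = br (br x y) z + br y (br x z)"
proof -
  have "br y (br z x) = - br y (br x z)"
    using assms br_antisym[of z x] br_minus_right[of y "br x z"] br_closed by simp
  moreover have "br z (br x y) = - br (br x y) z"
    using assms br_antisym[of z "br x y"] br_closed by simp
  ultimately show ?thesis using jacobi[OF assms] by (simp add: algebra_simps add_eq_0_iff)
qed

lemma root_space_subset: "root_space S \<alpha> \<subseteq> L"
  by (auto simp: root_space_def)

lemma root_spaceD: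
  assumes "x \<in> root_space S \<alpha>"
  shows "x \<in> L" and "h \<in> S \<Longrightarrow> br h x = scale (\<alpha> h) x"
  using assms by (auto simp: root_space_def)

lemma root_space_cong: "(\<And>h. h \<in> S \<Longrightarrow> \<alpha> h = \<beta> h) \<Longrightarrow> root_space S \<alpha> = root_space S \<beta>"
  by (auto simp: root_space_def)

lemma subspace_root_space:
  assumes "S \<subseteq> L"
  shows "subspace (root_space S \<alpha>)"
  using assms subspace_L
  by (auto simp: subspace_def root_space_def subsetD br_zero_right br_add_right br_scale_right
      scale_right_distrib mult.commute)

lemma br_root_space:
  assumes "S \<subseteq> L" "x \<in> root_space S \<alpha>" "y \<in> root_space S \<beta>"
  shows "br x y \<in> root_space S (\<lambda>h. \<alpha> h + \<beta> h)"
proof -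
  have xy: "x \<in> L" "y \<in> L" using assms root_space_subset by blast+
  have "br h (br x y) = scale (\<alpha> h + \<beta> h) (br x y)" if "h \<in> S" for h
  proof -
    have "br h (br x y) = br (scale (\<alpha> h) x) y + br x (scale (\<beta> h) y)"
      using br_derivation[of h x y] xy that assms by (auto simp: root_spaceD)
    then show ?thesis using xy by (simp add: br_scale_left br_scale_right scale_left_distrib)
  qed
  then show ?thesis using xy br_closed by (auto simp: root_space_def)
qed

text \<open>A subspace stable under \<open>S\<close> contains the weight components of each of its elements.  This is used with
  three kinds of \<open>I\<close>: the zero subspace (weight vectors of distinct weights are independent), a joint
  eigenspace (simultaneous diagonalisation), and an ideal (every ideal is a sum of weight spaces).\<close>

lemma weight_components:
  assumes "S \<subseteq> L" and I: "subspace I" and stable: "\<And>h x. h \<in> S \<Longrightarrow> x \<in> I \<Longrightarrow> br h x \<in> I"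
  assumes "finite F"
    and "\<And>i. i \<in> F \<Longrightarrow> v i \<in> root_space S (\<beta> i)"
    and "\<And>i j. i \<in> F \<Longrightarrow> j \<in> F \<Longrightarrow> i \<noteq> j \<Longrightarrow> \<exists>h\<in>S. \<beta> i h \<noteq> \<beta> j h"
    and "(\<Sum>i\<in>F. v i) \<in> I"
  shows "\<forall>i\<in>F. v i \<in> I"
  using assms(4-)
proof (induction F arbitrary: v rule: finite_induct)
  case empty
  then show ?case by simp
next
  case (insert k F)
  have vL: "v i \<in> L" if "i \<in> insert k F" for i
    using insert.prems(1)[OF that] root_space_subset by blast
  have vI: "v i \<in> I" if i: "i \<in> F" for i
  proof -
    from i insert.hyps insert.prems(2)[of i k] obtain h where h: "h \<in> S" "\<beta> i h \<noteq> \<beta> k h" by auto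
    \<comment> \<open>The operator \<open>ad h - \<beta> k h\<close> kills the component \<open>v k\<close> and multiplies \<open>v i\<close> by a nonzero scalar.\<close>
    let ?s = "\<Sum>j\<in>insert k F. v j"
    let ?w = "\<lambda>j. scale (\<beta> j h - \<beta> k h) (v j)"
    have "br h ?s = (\<Sum>j\<in>insert k F. scale (\<beta> j h) (v j))"
      using h vL assms(1) insert.prems(1)
      by (subst br_sum_right) (auto intro!: sum.cong root_spaceD(2) simp del: sum.insert)
    then have "br h ?s - scale (\<beta> k h) ?s = (\<Sum>j\<in>insert k F. ?w j)"
      by (simp add: scale_sum_right sum_subtractf scale_left_diff_distrib del: sum.insert)
    also have "\<dots> = (\<Sum>j\<in>F. ?w j)" using insert.hyps by simp
    finally have "(\<Sum>j\<in>F. ?w j) = br h ?s - scale (\<beta> k h) ?s" ..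
    moreover have "br h ?s - scale (\<beta> k h) ?s \<in> I"
      using stable[OF h(1) insert.prems(3)] subspace_scale[OF I insert.prems(3)]
      by (rule subspace_diff[OF I])
    ultimately have "(\<Sum>j\<in>F. ?w j) \<in> I" by simp
    moreover have "?w j \<in> root_space S (\<beta> j)" if "j \<in> F" for j
      using insert.prems(1) that by (intro subspace_scale subspace_root_space assms(1)) auto
    ultimately have "?w i \<in> I" using insert.IH[of ?w] insert.prems(2) i by blast
    then have "scale (1 / (\<beta> i h - \<beta> k h)) (?w i) \<in> I" by (rule subspace_scale[OF I])
    then show ?thesis using h(2) by simp
  qed
  have "(\<Sum>i\<in>F. v i) \<in> I" using vI by (rule subspace_sum[OF I])
  then have "(\<Sum>i\<in>insert k F. v i) - (\<Sum>i\<in>F. v i) \<in> I" using insert.prems(3) subspace_diff[OF I] by blast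
  then have "v k \<in> I" using insert.hyps by simp
  with vI show ?case by simp
qed

lemma independent_weight_vectors:
  assumes "S \<subseteq> L" "finite F"
    and B: "\<And>i. i \<in> F \<Longrightarrow> finite (B i)" "\<And>i. i \<in> F \<Longrightarrow> B i \<subseteq> root_space S (\<beta> i)"
      "\<And>i. i \<in> F \<Longrightarrow> independent (B i)"
    and dist: "\<And>i j. i \<in> F \<Longrightarrow> j \<in> F \<Longrightarrow> i \<noteq> j \<Longrightarrow> \<exists>h\<in>S. \<beta> i h \<noteq> \<beta> j h"
  shows "independent (\<Union>i\<in>F. B i)" and "card (\<Union>i\<in>F. B i) = (\<Sum>i\<in>F. card (B i))"
proof -
  have disj: "B i \<inter> B j = {}" if "i \<in> F" "j \<in> F" "i \<noteq> j" for i j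
  proof (rule ccontr)
    assume "B i \<inter> B j \<noteq> {}"
    then obtain b where b: "b \<in> B i" "b \<in> B j" by auto
    from dist[OF that] obtain h where h: "h \<in> S" "\<beta> i h \<noteq> \<beta> j h" by auto
    have "scale (\<beta> i h) b = scale (\<beta> j h) b" using b B(2) that h(1) root_spaceD(2) by (metis subsetD)
    then have "b = 0" using h(2) by (simp add: scale_right_imp_eq scale_cancel_right)
    then show False using b B(3) that dependent_zero by blast
  qed
  show "independent (\<Union>i\<in>F. B i)"
  proof (rule independent_if_scalars_zero)
    show "finite (\<Union>i\<in>F. B i)" using assms by auto
    fix u b assume sum: "(\<Sum>b\<in>(\<Union>i\<in>F. B i). scale (u b) b) = 0" and b: "b \<in> (\<Union>i\<in>F. B i)"
    define v where "v i = (\<Sum>b\<in>B i. scale (u b) b)" for i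
    have "(\<Sum>i\<in>F. v i) = 0"
      unfolding v_def sum[symmetric] using assms(2) B(1) disj
      by (subst sum.UNION_disjoint) auto
    then have "\<forall>i\<in>F. v i \<in> {0}"
      using assms(2) dist B(2) assms(1)
      by (intro weight_components[OF assms(1), of "{0}" F v \<beta>])
         (auto simp: br_zero_right subspace_single_0 v_def
           intro!: subspace_sum[OF subspace_root_space] subspace_scale[OF subspace_root_space])
    moreover from b obtain i where i: "i \<in> F" "b \<in> B i" by auto
    ultimately have "(\<Sum>b\<in>B i. scale (u b) b) = 0" unfolding v_def by auto
    then show "u b = 0" using i B(1,3) independentD by blast
  qed
  show "card (\<Union>i\<in>F. B i) = (\<Sum>i\<in>F. card (B i))"
    using assms(2) B(1) disj by (intro card_UN_disjoint) auto
qed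

text \<open>Decompose a joint eigenvector of \<open>F\<close> under one further \<open>k \<in> H\<close>: the joint eigenspace is stable under \<open>k\<close>
  because \<open>H\<close> is abelian, so it contains the components.\<close>

lemma simultaneous_eigenvectors:
  assumes H: "H \<subseteq> L" "\<And>h k. h \<in> H \<Longrightarrow> k \<in> H \<Longrightarrow> br h k = 0" "\<And>h. h \<in> H \<Longrightarrow> ad_diagonalizable h"
    and "finite F" "F \<subseteq> H"
  shows "L \<subseteq> span (\<Union>\<alpha>. root_space F \<alpha>)"
  using assms(4,5)
proof (induction F rule: finite_induct)
  case empty
  have "L \<subseteq> root_space {} \<alpha>" for \<alpha> by (auto simp: root_space_def)
  then show ?case using span_superset by blast
next
  case (insert k F)
  have kL: "k \<in> L" and FL: "F \<subseteq> L" using insert.prems H by auto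
  have "x \<in> span (\<Union>\<alpha>. root_space (insert k F) \<alpha>)" if x: "x \<in> root_space F \<alpha>" for x \<alpha>
  proof -
    have xL: "x \<in> L" using x root_space_subset by blast
    have "L = span {x \<in> L. \<exists>c. br k x = scale c x}"
      using H(3) insert.prems by (auto simp: ad_diagonalizable_def)
    also have "{x \<in> L. \<exists>c. br k x = scale c x} = (\<Union>c. root_space {k} (\<lambda>_. c))"
      by (auto simp: root_space_def)
    finally have xs: "x \<in> span (\<Union>c. root_space {k} (\<lambda>_. c))" using xL by simp
    obtain M v where M: "finite M" "\<And>c. c \<in> M \<Longrightarrow> v c \<in> root_space {k} (\<lambda>_. c)" "x = (\<Sum>c\<in>M. v c)"
      using span_Union_sum[OF _ xs] subspace_root_space[of "{k}"] kL by auto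
    have stable: "br k y \<in> root_space F \<alpha>" if y: "y \<in> root_space F \<alpha>" for y
    proof -
      have "k \<in> root_space F (\<lambda>_. 0)" using kL insert.prems H(2) by (auto simp: root_space_def)
      from br_root_space[OF FL this y] show ?thesis by simp
    qed
    have "\<forall>c\<in>M. v c \<in> root_space F \<alpha>"
    proof (rule weight_components[of "{k}" "root_space F \<alpha>" M v "\<lambda>c _. c"])
      show "(\<Sum>c\<in>M. v c) \<in> root_space F \<alpha>" using x M(3) by simp
    qed (use M stable kL subspace_root_space[OF FL] in auto)
    then have "v c \<in> root_space (insert k F) (\<lambda>h. if h = k then c else \<alpha> h)" if "c \<in> M" for c
      using M(2)[OF that] that insert.hyps by (auto simp: root_space_def)
    then have "v c \<in> span (\<Union>\<alpha>. root_space (insert k F) \<alpha>)" if "c \<in> M" for c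
      using that by (intro span_base) blast
    then show ?thesis unfolding M(3) by (rule span_sum)
  qed
  then have "(\<Union>\<alpha>. root_space F \<alpha>) \<subseteq> span (\<Union>\<alpha>. root_space (insert k F) \<alpha>)" by blast
  then have "span (\<Union>\<alpha>. root_space F \<alpha>) \<subseteq> span (\<Union>\<alpha>. root_space (insert k F) \<alpha>)"
    by (rule span_minimal) simp
  with insert show ?case by blast
qed

text \<open>A basis of \<open>H\<close> is finite, so that the simultaneous diagonalisation applies to it; an eigenvector for a basis is
  an eigenvector for its span.\<close>

lemma root_space_decomposition:
  assumes fd: "finite_dim" and H: "cartan_subalgebra H"
  shows "L \<subseteq> span (\<Union>\<alpha>. root_space H \<alpha>)"
proof -
  have HL: "H \<subseteq> L" and sH: "subspace H" using H by (auto simp: cartan_subalgebra_def)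
  from fd obtain B where B: "finite B" "L = span B" by (auto simp: finite_dim_def)
  obtain C where C: "C \<subseteq> H" "independent C" "H \<subseteq> span C" using maximal_independent_subset by blast
  have finC: "finite C" using independent_span_bound[OF B(1) C(2)] C HL B by blast
  have "L \<subseteq> span (\<Union>\<alpha>. root_space C \<alpha>)"
    using H C(1) finC by (intro simultaneous_eigenvectors[of H]) (auto simp: cartan_subalgebra_def)
  also have "\<dots> \<subseteq> span (\<Union>\<alpha>. root_space H \<alpha>)"
  proof (intro span_mono subsetI)
    fix x assume "x \<in> (\<Union>\<alpha>. root_space C \<alpha>)"
    then obtain \<alpha> where x: "x \<in> root_space C \<alpha>" by auto
    have xL: "x \<in> L" using x root_space_subset by blast
    let ?E = "{h \<in> L. \<exists>c. br h x = scale c x}"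
    have "subspace ?E"
      unfolding subspace_def using subspace_L xL
      by (auto simp: br_zero_left subspace_0 subspace_add subspace_scale br_add_left br_scale_left
          simp flip: scale_left_distrib intro: exI[of _ 0])
    moreover have "C \<subseteq> ?E" using x C(1) HL by (auto simp: root_space_def)
    ultimately have "span C \<subseteq> ?E" by (rule span_minimal[rotated])
    then have "\<forall>h\<in>H. \<exists>c. br h x = scale c x" using C(3) by blast
    then obtain \<beta> where "\<forall>h\<in>H. br h x = scale (\<beta> h) x" by metis
    then show "x \<in> (\<Union>\<alpha>. root_space H \<alpha>)" using xL by (auto simp: root_space_def)
  qed
  finally show ?thesis .
qed

end

section \<open>Representations of sl(2) on a Lie algebra\<close>

context complex_lie_algebra
begin

text \<open>The commutator of \<open>e\<close> with \<open>f^k\<close> on a vector of weight \<open>m\<close>.  For \<open>k = 0\<close> the exponent \<open>k - 1\<close> is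
  harmless, because its term has coefficient 0.\<close>

lemma sl2_raise_lowered:
  assumes L: "e \<in> L" "f \<in> L" "h \<in> L" and ef: "br e f = h" and hf: "br h f = scale (- 2) f"
    and v: "v \<in> L" "br h v = scale m v"
  shows "br h ((br f ^^ k) v) = scale (m - 2 * of_nat k) ((br f ^^ k) v)"
    and "br e ((br f ^^ k) v)
      = (br f ^^ k) (br e v) + scale (of_nat k * (m - of_nat k + 1)) ((br f ^^ (k - 1)) v)"
proof -
  have pow: "(br f ^^ k) w \<in> L" if "w \<in> L" for k w
    using that by (induction k) (auto simp: br_closed L)
  have wt: "br h ((br f ^^ k) v) = scale (m - 2 * of_nat k) ((br f ^^ k) v)" for k
  proof (induction k)
    case (Suc k)
    let ?u = "(br f ^^ k) v"
    have "br h (br f ?u) = scale (- 2) (br f ?u) + scale (m - 2 * of_nat k) (br f ?u)"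
      using br_derivation[of h f ?u] br_scale_left[of f ?u "- 2"] L pow[OF v(1)] Suc
      by (simp add: hf br_scale_right)
    also have "\<dots> = scale (- 2 + (m - 2 * of_nat k)) (br f ?u)"
      by (simp only: scale_left_distrib)
    finally show ?case by (simp add: algebra_simps)
  qed (simp add: v)
  show "br h ((br f ^^ k) v) = scale (m - 2 * of_nat k) ((br f ^^ k) v)" by (rule wt)
  show "br e ((br f ^^ k) v)
      = (br f ^^ k) (br e v) + scale (of_nat k * (m - of_nat k + 1)) ((br f ^^ (k - 1)) v)"
  proof (induction k)
    case (Suc k)
    let ?u = "(br f ^^ k) v"
    have step: "br f (scale (of_nat k * c) ((br f ^^ (k - 1)) v)) = scale (of_nat k * c) ?u" for c
      using L pow[OF v(1)] by (cases k) (simp_all add: br_scale_right br_zero_right)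
    have "br e (br f ?u) = scale (m - 2 * of_nat k) ?u + br f (br e ?u)"
      using br_derivation[of e f ?u] L pow[OF v(1)] by (simp add: ef wt)
    also have "br f (br e ?u)
        = (br f ^^ Suc k) (br e v) + scale (of_nat k * (m - of_nat k + 1)) ?u"
      unfolding Suc.IH using L pow v br_closed subspace_scale[OF subspace_L]
      by (subst br_add_right) (simp_all add: step del: One_nat_def)
    finally have "br e (br f ?u) = (br f ^^ Suc k) (br e v)
        + scale ((m - 2 * of_nat k) + of_nat k * (m - of_nat k + 1)) ?u"
      by (simp only: scale_left_distrib add_ac)
    moreover have "(m - 2 * of_nat k) + of_nat k * (m - of_nat k + 1)
        = of_nat (Suc k) * (m - of_nat (Suc k) + 1)"
      by (simp add: algebra_simps)
    ultimately show ?case by simp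
  qed simp
qed

text \<open>Induction on the nilpotency index \<open>N\<close> of \<open>e\<close> at \<open>v\<close>.  If \<open>f^j v = 0\<close> then \<open>f^(j+1) (e v) = 0\<close> by the
  commutator formula, and \<open>e v\<close> has weight \<open>m + 2\<close>, so \<open>e v = 0\<close> by induction.  For a highest weight
  vector, \<open>e f^(i+1) v\<close> is a nonzero multiple of \<open>f^i v\<close> as long as \<open>i < m\<close>, and the exponent descends to 0.\<close>

lemma sl2_lowering_injective:
  assumes L: "e \<in> L" "f \<in> L" "h \<in> L" and ef: "br e f = h"
    and he: "br h e = scale 2 e" and hf: "br h f = scale (- 2) f"
    and v: "v \<in> L" "br h v = scale (of_nat m) v"
    and nil: "(br e ^^ N) v = 0" and zero: "(br f ^^ j) v = 0" and "j \<le> m"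
  shows "v = 0"
  using v nil zero \<open>j \<le> m\<close>
proof (induction N arbitrary: v m j)
  case (Suc N)
  note raise = sl2_raise_lowered(2)[OF L ef hf Suc.prems(1,2)]
  have f0: "(br f ^^ k) 0 = 0" for k by (induction k) (auto simp: br_zero_right L)
  have ev: "br e v = 0"
  proof (rule Suc.IH[of "br e v" "m + 2" "Suc j"])
    show "br e v \<in> L" using L Suc.prems br_closed by blast
    have "br h (br e v) = scale 2 (br e v) + scale (of_nat m) (br e v)"
      using br_derivation[of h e v] L Suc.prems by (simp add: he br_scale_left br_scale_right)
    then show "br h (br e v) = scale (of_nat (m + 2)) (br e v)"
      by (simp only: of_nat_add of_nat_numeral scale_left_distrib add.commute)
    show "(br e ^^ N) (br e v) = 0" using Suc.prems(3) by (simp add: funpow_swap1)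
    have "(br f ^^ Suc j) v = 0" using Suc.prems(4) L by (simp add: br_zero_right)
    then show "(br f ^^ Suc j) (br e v) = 0" using raise[of "Suc j"] Suc.prems(4) L
      by (simp add: br_zero_right)
  qed (use Suc.prems in simp)
  have "(br f ^^ i) v = 0 \<Longrightarrow> i \<le> m \<Longrightarrow> v = 0" for i
  proof (induction i)
    case (Suc i)
    have "scale (of_nat (Suc i) * (of_nat m - of_nat i)) ((br f ^^ i) v) = 0"
      using raise[of "Suc i"] Suc.prems ev f0[of "Suc i"] L by (simp add: br_zero_right)
    moreover have "of_nat (Suc i) * (of_nat m - of_nat i) \<noteq> (0 :: complex)"
      using Suc.prems(2) by (auto simp del: of_nat_Suc)
    ultimately have "(br f ^^ i) v = 0" by (metis scale_eq_0_iff)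
    with Suc show ?case by simp
  qed simp
  from this[OF Suc.prems(4,5)] show ?case .
qed simp

lemma funpow_br_root_space:
  assumes "S \<subseteq> L" "e \<in> root_space S \<alpha>" "v \<in> root_space S \<beta>"
  shows "(br e ^^ k) v \<in> root_space S (\<lambda>h. \<beta> h + of_nat k * \<alpha> h)"
proof (induction k)
  case (Suc k)
  from br_root_space[OF assms(1,2) this] show ?case by (simp add: algebra_simps)
qed (use assms in simp)

text \<open>The vectors \<open>e^k v\<close> have the distinct weights \<open>\<beta> + k\<alpha>\<close>; if none of them vanished, they would be an
  infinite independent family.\<close>

lemma root_vector_nilpotent:
  assumes fd: "finite_dim" and S: "S \<subseteq> L" and e: "e \<in> root_space S \<alpha>" and h: "h \<in> S" "\<alpha> h \<noteq> 0"
    and v: "v \<in> root_space S \<beta>"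
  obtains N where "(br e ^^ N) v = 0"
proof (rule ccontr)
  assume "\<not> thesis"
  then have nz: "(br e ^^ k) v \<noteq> 0" for k using that by blast
  from fd obtain B where B: "finite B" "L = span B" by (auto simp: finite_dim_def)
  define \<gamma> where "\<gamma> k = (\<lambda>h. \<beta> h + of_nat k * \<alpha> h)" for k :: nat
  note w = funpow_br_root_space[OF S e v]
  let ?B = "\<lambda>k. {(br e ^^ k) v}"
  have "independent (\<Union>k\<in>{..card B}. ?B k)" "card (\<Union>k\<in>{..card B}. ?B k) = (\<Sum>k\<in>{..card B}. card (?B k))"
    using independent_weight_vectors[OF S, of "{..card B}" ?B \<gamma>] w nz h by (auto simp: \<gamma>_def)
  moreover have "(\<Union>k\<in>{..card B}. ?B k) \<subseteq> span B" using w root_space_subset B(2) by blast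
  ultimately show False using independent_span_bound[OF B(1)] by fastforce
qed

end

section \<open>Reflections of root spaces\<close>

context complex_lie_algebra
begin

definition one_dim :: "'a set \<Rightarrow> bool" where
  "one_dim V \<longleftrightarrow> (\<exists>x. x \<noteq> 0 \<and> V = span {x})"

lemma one_dim_nonzero: "one_dim V \<Longrightarrow> V \<noteq> {0}"
  unfolding one_dim_def using span_base by blast

lemma one_dimI:
  assumes "subspace V" "x \<in> V" "x \<noteq> 0" "\<And>y. y \<in> V \<Longrightarrow> \<exists>c. y = scale c x"
  shows "one_dim V"
  unfolding one_dim_def
proof (intro exI conjI)
  show "V = span {x}"
    using assms span_minimal[of "{x}" V] by (auto simp: span_singleton)
qed fact

text \<open>A function that occurs as the weight of a nonzero vector is linear on \<open>H\<close>.\<close>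

lemma root_linear:
  assumes H: "subspace H" "H \<subseteq> L" and x: "x \<in> root_space H \<alpha>" "x \<noteq> 0" and h: "h \<in> H" "k \<in> H"
  shows "\<alpha> (h + k) = \<alpha> h + \<alpha> k" and "\<alpha> (scale c h) = c * \<alpha> h"
proof -
  have L: "x \<in> L" "h \<in> L" "k \<in> L" using root_spaceD(1) x h H by auto
  have "scale (\<alpha> (h + k)) x = br (h + k) x"
    using root_spaceD(2)[OF x(1)] h subspace_add[OF H(1)] by simp
  also have "\<dots> = scale (\<alpha> h + \<alpha> k) x"
    using L h root_spaceD(2)[OF x(1)] by (simp add: br_add_left scale_left_distrib)
  finally show "\<alpha> (h + k) = \<alpha> h + \<alpha> k" using x(2) by (simp add: scale_cancel_right)
  have "scale (\<alpha> (scale c h)) x = br (scale c h) x"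
    using root_spaceD(2)[OF x(1)] h subspace_scale[OF H(1)] by simp
  also have "\<dots> = scale (c * \<alpha> h) x"
    using L h root_spaceD(2)[OF x(1)] by (simp add: br_scale_left)
  finally show "\<alpha> (scale c h) = c * \<alpha> h" using x(2) by (simp add: scale_cancel_right)
qed

lemma lowering_injective_on_root_space:
  assumes fd: "finite_dim" and H: "H \<subseteq> L"
    and e: "e \<in> root_space H \<alpha>" and f: "f \<in> root_space H (\<lambda>h. - \<alpha> h)"
    and h: "br e f = h" "h \<in> H" "\<alpha> h = 2"
    and v: "v \<in> root_space H \<beta>" "\<beta> h = of_nat m" and "(br f ^^ j) v = 0" "j \<le> m"
  shows "v = 0"
proof -
  obtain N where N: "(br e ^^ N) v = 0"
    using root_vector_nilpotent[OF fd H e h(2) _ v(1)] h(3) by auto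
  show ?thesis
  proof (rule sl2_lowering_injective[of e f h v m N j])
    show "br h e = scale 2 e" "br h f = scale (- 2) f" "br h v = scale (of_nat m) v"
      using root_spaceD(2)[OF e h(2)] root_spaceD(2)[OF f h(2)] root_spaceD(2)[OF v(1) h(2)] h v
      by simp_all
  qed (use assms N root_spaceD(1) in auto)
qed

text \<open>Both \<open>f^m\<close> from the root space of \<open>\<beta>\<close> to that of \<open>\<beta> - m\<alpha>\<close> and \<open>e^m\<close> in the other direction are
  injective, the second because exchanging \<open>e\<close> and \<open>f\<close> and negating \<open>h\<close> gives another sl(2)-triple.  As one of the
  two spaces is a line, so is the other.  The values at \<open>- h\<close>, assumed here, follow from
  the linearity of roots.\<close>

lemma one_dim_reflection:
  assumes fd: "finite_dim" and H: "H \<subseteq> L"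
    and e: "e \<in> root_space H \<alpha>" and f: "f \<in> root_space H (\<lambda>h. - \<alpha> h)"
    and h: "br e f = h" "h \<in> H" "\<alpha> h = 2"
    and h': "- h \<in> H" "\<alpha> (- h) = - 2" "\<beta> (- h) = - of_nat m"
    and m: "\<beta> h = of_nat m" and one: "one_dim (root_space H \<beta>)"
  shows "one_dim (root_space H (\<lambda>k. \<beta> k - of_nat m * \<alpha> k))"
proof -
  let ?\<gamma> = "\<lambda>k. \<beta> k - of_nat m * \<alpha> k"
  from one obtain x where x: "x \<noteq> 0" "root_space H \<beta> = span {x}" unfolding one_dim_def by blast
  have xR: "x \<in> root_space H \<beta>" using x span_base by blast
  have efL: "e \<in> L" "f \<in> L" using e f root_spaceD(1) by auto
  define y where "y = (br f ^^ m) x"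
  have yR: "y \<in> root_space H ?\<gamma>"
    unfolding y_def using funpow_br_root_space[OF H f xR, of m] by simp
  have up: "(br e ^^ m) z \<in> root_space H \<beta>" if "z \<in> root_space H ?\<gamma>" for z
    using funpow_br_root_space[OF H e that, of m] by simp
  have up_inj: "z = 0" if z: "z \<in> root_space H ?\<gamma>" "(br e ^^ m) z = 0" for z
  proof (rule lowering_injective_on_root_space[OF fd H f _ _ h'(1) _ z(1) _ z(2) order.refl])
    show "br f e = - h" using br_antisym[of f e] efL h by simp
  qed (use h h' e in simp_all)
  have y0: "y \<noteq> 0"
    using lowering_injective_on_root_space[OF fd H e f h xR m _ order.refl] x(1) y_def by auto
  have pow: "(br e ^^ k) w \<in> L" if "w \<in> L" for w k
    using that by (induction k) (simp_all add: br_closed efL)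
  have lin: "(br e ^^ k) (z - scale c y) = (br e ^^ k) z - scale c ((br e ^^ k) y)"
    if L: "z \<in> L" "y \<in> L" for z c k
  proof (induction k)
    case (Suc k)
    show ?case unfolding funpow.simps o_apply Suc.IH
      using pow[OF L(1)] pow[OF L(2)] subspace_scale[OF subspace_L] efL
      by (simp add: br_diff_right br_scale_right)
  qed simp
  show ?thesis
  proof (rule one_dimI[OF subspace_root_space[OF H] yR y0])
    fix z assume z: "z \<in> root_space H ?\<gamma>"
    obtain c where c: "(br e ^^ m) z = scale c x" using up[OF z] x by (auto simp: span_singleton)
    obtain d where d: "(br e ^^ m) y = scale d x" using up[OF yR] x by (auto simp: span_singleton)
    have "d \<noteq> 0" using up_inj[OF yR] d y0 by auto
    have "(br e ^^ m) (z - scale (c / d) y) = 0"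
      using lin[where k = m and c = "c / d" and z = z] root_spaceD(1) z yR c d \<open>d \<noteq> 0\<close> by simp
    moreover have "z - scale (c / d) y \<in> root_space H ?\<gamma>"
      using z yR subspace_root_space[OF H] by (intro subspace_diff subspace_scale) auto
    ultimately have "z - scale (c / d) y = 0" by (rule up_inj[rotated])
    then show "\<exists>c. z = scale c y" by auto
  qed
qed

end

section \<open>Simple Lie algebras with a chosen base\<close>

text \<open>The witnesses hidden in the existence of a Cartan matrix, with root vectors \<open>e i\<close>, \<open>f i\<close> for the simple roots
  and their negatives.  The Cartan matrix itself enters only in the rank two case.\<close>

locale based_lie_algebra = complex_lie_algebra scale L br
  for scale :: "complex \<Rightarrow> 'a::ab_group_add \<Rightarrow> 'a" and L br +
  fixes H :: "'a set" and n :: nat and \<alpha> :: "nat \<Rightarrow> 'a \<Rightarrow> complex" and e f :: "nat \<Rightarrow> 'a"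
  assumes fd: "finite_dim" and simple: "simple" and cartan: "cartan_subalgebra H"
    and base: "is_base H n \<alpha>"
    and e: "i < n \<Longrightarrow> e i \<in> root_space H (\<alpha> i)"
    and f: "i < n \<Longrightarrow> f i \<in> root_space H (\<lambda>h. - \<alpha> i h)"
    and coroot_2: "i < n \<Longrightarrow> \<alpha> i (br (e i) (f i)) = 2"
begin

abbreviation coroot :: "nat \<Rightarrow> 'a" where "coroot i \<equiv> br (e i) (f i)"

lemma H_subset: "H \<subseteq> L" and subspace_H: "subspace H"
  using cartan by (auto simp: cartan_subalgebra_def)

lemma zero_root_space: "root_space H (\<lambda>_. 0) = H"
  using cartan by (auto simp: cartan_subalgebra_def root_space_def)

lemma coroot_in_H: "i < n \<Longrightarrow> coroot i \<in> H"
  using br_root_space[OF H_subset e f, of i i] zero_root_space by simp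

lemma e_in_L: "i < n \<Longrightarrow> e i \<in> L" and f_in_L: "i < n \<Longrightarrow> f i \<in> L"
  using e f root_spaceD(1) by blast+

lemma
  assumes nz: "root_space H \<beta> \<noteq> {0}" and h: "h \<in> H"
  shows root_add: "k \<in> H \<Longrightarrow> \<beta> (h + k) = \<beta> h + \<beta> k" and root_scale: "\<beta> (scale c h) = c * \<beta> h"
    and root_minus: "\<beta> (- h) = - \<beta> h" and root_diff: "k \<in> H \<Longrightarrow> \<beta> (h - k) = \<beta> h - \<beta> k"
proof -
  have "0 \<in> root_space H \<beta>" using subspace_0[OF subspace_root_space[OF H_subset]] .
  with nz obtain x where x: "x \<in> root_space H \<beta>" "x \<noteq> 0" by blast
  note lin = root_linear[OF subspace_H H_subset x]
  show "k \<in> H \<Longrightarrow> \<beta> (h + k) = \<beta> h + \<beta> k" "\<beta> (scale c h) = c * \<beta> h" using lin h by auto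
  have neg: "\<beta> (- k) = - \<beta> k" if "k \<in> H" for k using lin(2)[OF that that, of "- 1"] by simp
  show "\<beta> (- h) = - \<beta> h" by (rule neg[OF h])
  show "\<beta> (h - k) = \<beta> h - \<beta> k" if "k \<in> H"
    using lin(1)[OF h subspace_neg[OF subspace_H that]] neg[OF that] by simp
qed

lemma simple_root_nonzero: "i < n \<Longrightarrow> root_space H (\<alpha> i) \<noteq> {0}"
  using base by (auto simp: is_base_def is_root_def)

lemmas simple_root_minus = root_minus[OF simple_root_nonzero]

lemma neg_coroot: "i < n \<Longrightarrow> - coroot i \<in> H" "i < n \<Longrightarrow> \<alpha> i (- coroot i) = - 2"
  "i < n \<Longrightarrow> br (f i) (e i) = - coroot i"
  using coroot_in_H subspace_neg[OF subspace_H] simple_root_minus coroot_2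
    br_antisym[OF f_in_L e_in_L] by auto

text \<open>For \<open>m < 0\<close> the roles of \<open>e i\<close> and \<open>f i\<close> are exchanged.\<close>

lemma reflection_nonzero:
  assumes i: "i < n" and nz: "root_space H \<beta> \<noteq> {0}" and m: "\<beta> (coroot i) = of_int m"
  shows "root_space H (\<lambda>h. \<beta> h - of_int m * \<alpha> i h) \<noteq> {0}"
proof -
  have "0 \<in> root_space H \<beta>" using subspace_0[OF subspace_root_space[OF H_subset]] .
  with nz obtain x where x: "x \<in> root_space H \<beta>" "x \<noteq> 0" by blast
  show ?thesis
  proof (cases "m \<ge> 0")
    case True
    then have m': "\<beta> (coroot i) = of_nat (nat m)" using m by simp
    have "(br (f i) ^^ nat m) x \<noteq> 0"
      using lowering_injective_on_root_space[OF fd H_subset e[OF i] f[OF i] refl coroot_in_H[OF i]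
          coroot_2[OF i] x(1) m' _ order.refl] x(2) by blast
    moreover have "(br (f i) ^^ nat m) x \<in> root_space H (\<lambda>h. \<beta> h - of_int m * \<alpha> i h)"
      using funpow_br_root_space[OF H_subset f[OF i] x(1), of "nat m"] True by simp
    ultimately show ?thesis by blast
  next
    case False
    then have m': "\<beta> (- coroot i) = of_nat (nat (- m))"
      using m root_minus[OF nz coroot_in_H[OF i]] by simp
    have e': "e i \<in> root_space H (\<lambda>h. - (- \<alpha> i h))" using e[OF i] by simp
    have "(br (e i) ^^ nat (- m)) x \<noteq> 0"
      using lowering_injective_on_root_space[OF fd H_subset f[OF i] e' neg_coroot(3)[OF i]
          neg_coroot(1)[OF i] _ x(1) m' _ order.refl] x(2) neg_coroot(2)[OF i] by auto
    moreover have "(br (e i) ^^ nat (- m)) x \<in> root_space H (\<lambda>h. \<beta> h - of_int m * \<alpha> i h)"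
      using funpow_br_root_space[OF H_subset e[OF i] x(1), of "nat (- m)"] False by simp
    ultimately show ?thesis by blast
  qed
qed

lemma reflection_one_dim:
  assumes i: "i < n" and one: "one_dim (root_space H \<beta>)" and m: "\<beta> (coroot i) = of_int m"
  shows "one_dim (root_space H (\<lambda>h. \<beta> h - of_int m * \<alpha> i h))"
proof -
  have neg: "\<beta> (- coroot i) = - of_int m"
    using m root_minus[OF one_dim_nonzero[OF one] coroot_in_H[OF i]] by simp
  show ?thesis
  proof (cases "m \<ge> 0")
    case True
    then show ?thesis
      using one_dim_reflection[OF fd H_subset e[OF i] f[OF i] refl coroot_in_H[OF i] coroot_2[OF i]
          neg_coroot(1,2)[OF i], of \<beta> "nat m"] one m neg by simp
  next
    case False
    have e': "e i \<in> root_space H (\<lambda>h. - (- \<alpha> i h))" using e[OF i] by simp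
    show ?thesis
      using one_dim_reflection[OF fd H_subset f[OF i] e' neg_coroot(3)[OF i] neg_coroot(1)[OF i],
          of \<beta> "nat (- m)"] one m neg False neg_coroot(2)[OF i] coroot_2[OF i] coroot_in_H[OF i]
      by simp
  qed
qed

lemma bracket_f_H:
  assumes "i < n" "k \<in> H"
  shows "br (f i) k = scale (\<alpha> i k) (f i)"
proof -
  have "br k (f i) = - scale (\<alpha> i k) (f i)" using root_spaceD(2)[OF f[OF assms(1)] assms(2)] by simp
  moreover have "k \<in> L" using assms(2) H_subset by blast
  ultimately show ?thesis using br_antisym[OF f_in_L[OF assms(1)]] by simp
qed

text \<open>For \<open>v\<close> in the root space, \<open>f (f v)\<close> is a multiple of \<open>f i\<close>, as is \<open>f (f e)\<close> with factor \<open>-2\<close>.  Hence some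
  combination of \<open>v\<close> and \<open>e i\<close> is killed by \<open>f^2\<close>, but it has weight 2, so it vanishes.\<close>

lemma simple_root_one_dim:
  assumes i: "i < n"
  shows "one_dim (root_space H (\<alpha> i))"
proof (rule one_dimI[OF subspace_root_space[OF H_subset] e[OF i]])
  note L = e_in_L[OF i] f_in_L[OF i]
  show "e i \<noteq> 0"
  proof
    assume "e i = 0"
    then have "coroot i = 0" using br_zero_left[OF L(2)] by simp
    then show False using coroot_2[OF i] simple_root_minus[OF i coroot_in_H[OF i]] by simp
  qed
  fix v assume v: "v \<in> root_space H (\<alpha> i)"
  have vL: "v \<in> L" using root_spaceD(1)[OF v] .
  have fv: "br (f i) v \<in> H" using br_root_space[OF H_subset f[OF i] v] zero_root_space by simp
  define c where "c = \<alpha> i (br (f i) v) / 2"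
  have ff: "br (f i) (br (f i) v) = scale (2 * c) (f i)"
    using bracket_f_H[OF i fv] by (simp add: c_def)
  have fe: "br (f i) (br (f i) (e i)) = scale (- 2) (f i)"
    using bracket_f_H[OF i neg_coroot(1)[OF i]] neg_coroot(2,3)[OF i] by simp
  let ?w = "v + scale c (e i)"
  have "br (f i) (br (f i) ?w) = br (f i) (br (f i) v) + scale c (br (f i) (br (f i) (e i)))"
    using L vL br_closed subspace_scale[OF subspace_L] by (simp add: br_add_right br_scale_right)
  also have "\<dots> = 0" unfolding ff fe by simp
  finally have "(br (f i) ^^ 2) ?w = 0" by (simp add: numeral_2_eq_2)
  moreover have "?w \<in> root_space H (\<alpha> i)"
    using v e[OF i] subspace_root_space[OF H_subset] by (intro subspace_add subspace_scale) auto
  ultimately have "?w = 0"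
    using lowering_injective_on_root_space[OF fd H_subset e[OF i] f[OF i] refl coroot_in_H[OF i]
        coroot_2[OF i], of ?w "\<alpha> i" 2 2] coroot_2[OF i] by simp
  then have "v = scale (- c) (e i)" by (simp add: eq_neg_iff_add_eq_0)
  then show "\<exists>c. v = scale c (e i)" by blast
qed

text \<open>Lowering \<open>k\<close> times leads into \<open>H\<close>, once more into the line of \<open>f i\<close>, and a further time to 0.  Since the
  weight is \<open>2k \<ge> k + 2\<close>, the vector itself is 0; this is where \<open>k \<ge> 2\<close> matters.\<close>

lemma multiple_not_root:
  assumes i: "i < n" and k: "k \<ge> 2"
  shows "root_space H (\<lambda>h. of_nat k * \<alpha> i h) = {0}"
proof -
  have "v = 0" if v: "v \<in> root_space H (\<lambda>h. of_nat k * \<alpha> i h)" for v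
  proof -
    let ?u = "(br (f i) ^^ k) v"
    have u: "?u \<in> H" using funpow_br_root_space[OF H_subset f[OF i] v, of k] zero_root_space by simp
    have "br (f i) (br (f i) ?u) = 0"
      unfolding bracket_f_H[OF i u] using f_in_L[OF i] by (simp add: br_scale_right br_self)
    then have "(br (f i) ^^ (k + 2)) v = 0" by simp
    then show ?thesis
      using lowering_injective_on_root_space[OF fd H_subset e[OF i] f[OF i] refl coroot_in_H[OF i]
          coroot_2[OF i] v, of "2 * k" "k + 2"] coroot_2[OF i] k by simp
  qed
  then show ?thesis using subspace_0[OF subspace_root_space[OF H_subset]] by auto
qed

text \<open>An element of \<open>H\<close> on which the simple roots vanish is annihilated by all roots, hence central; the
  centre of a simple Lie algebra is 0.\<close>

lemma simple_roots_separate: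
  assumes h: "h \<in> H" and zero: "\<And>i. i < n \<Longrightarrow> \<alpha> i h = 0"
  shows "h = 0"
proof -
  have hL: "h \<in> L" using h H_subset by blast
  let ?C = "{x \<in> L. br h x = 0}"
  have "subspace ?C"
    using subspace_L hL by (auto simp: subspace_def br_zero_right br_add_right br_scale_right)
  moreover have "root_space H \<beta> \<subseteq> ?C" for \<beta>
  proof
    fix x assume x: "x \<in> root_space H \<beta>"
    have "br h x = 0"
    proof (cases "x = 0 \<or> \<beta> h = 0")
      case True
      then show ?thesis using root_spaceD(2)[OF x h] by (auto simp: hL br_zero_right)
    next
      case False
      then have "is_root H \<beta>" using x h by (auto simp: is_root_def)
      with base obtain c :: "nat \<Rightarrow> nat" where "\<beta> h = (\<Sum>i<n. of_nat (c i) * \<alpha> i h) \<or>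
          \<beta> h = - (\<Sum>i<n. of_nat (c i) * \<alpha> i h)"
        using h unfolding is_base_def by blast
      then have "\<beta> h = 0" using zero by auto
      then show ?thesis using root_spaceD(2)[OF x h] by simp
    qed
    then show "x \<in> ?C" using root_spaceD(1)[OF x] by simp
  qed
  ultimately have C: "L \<subseteq> ?C"
    using root_space_decomposition[OF fd cartan] span_minimal[of "\<Union>\<beta>. root_space H \<beta>" ?C] by blast
  let ?Z = "{z \<in> L. \<forall>x\<in>L. br x z = 0}"
  have "subspace ?Z"
    using subspace_L by (auto simp: subspace_def br_zero_right br_add_right br_scale_right)
  then have "ideal ?Z" using br_closed zero_in_L br_zero_right by (auto simp: ideal_def)
  moreover have "?Z \<noteq> L" using simple by (auto simp: simple_def)
  ultimately have "?Z = {0}" using simple by (auto simp: simple_def)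
  moreover have "h \<in> ?Z"
  proof -
    have "br x h = 0" if "x \<in> L" for x
      using br_antisym[OF that hL] C that by auto
    then show ?thesis using hL by blast
  qed
  ultimately show ?thesis by blast
qed

text \<open>A basis of \<open>H\<close> together with one vector from each root space is a basis of \<open>L\<close>.\<close>

lemma dim_from_roots:
  assumes C: "finite C" "C \<subseteq> H" "independent C" "H \<subseteq> span C"
    and \<Phi>: "finite \<Phi>" "\<And>r. r \<in> \<Phi> \<Longrightarrow> one_dim (root_space H (\<gamma> r))"
      "\<And>r. r \<in> \<Phi> \<Longrightarrow> \<exists>h\<in>H. \<gamma> r h \<noteq> 0"
      "\<And>r s. r \<in> \<Phi> \<Longrightarrow> s \<in> \<Phi> \<Longrightarrow> r \<noteq> s \<Longrightarrow> \<exists>h\<in>H. \<gamma> r h \<noteq> \<gamma> s h"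
      "\<And>\<beta>. is_root H \<beta> \<Longrightarrow> \<exists>r\<in>\<Phi>. \<forall>h\<in>H. \<beta> h = \<gamma> r h"
  shows "dim L = card C + card \<Phi>"
proof -
  from \<Phi>(2) have "\<forall>r\<in>\<Phi>. \<exists>x. x \<noteq> 0 \<and> root_space H (\<gamma> r) = span {x}" by (auto simp: one_dim_def)
  then obtain x where x: "\<And>r. r \<in> \<Phi> \<Longrightarrow> x r \<noteq> 0 \<and> root_space H (\<gamma> r) = span {x r}" by metis
  \<comment> \<open>The index \<open>None\<close> stands for the weight 0, whose weight space is \<open>H\<close>.\<close>
  define B where "B r = (case r of None \<Rightarrow> C | Some r \<Rightarrow> {x r})" for r
  define \<beta> where "\<beta> r = (case r of None \<Rightarrow> (\<lambda>_. 0) | Some r \<Rightarrow> \<gamma> r)" for r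
  let ?F = "insert None (Some ` \<Phi>)"
  have BR: "B r \<subseteq> root_space H (\<beta> r)" if "r \<in> ?F" for r
    using that x C(2) zero_root_space span_base by (auto simp: B_def \<beta>_def)
  have dist: "\<exists>h\<in>H. \<beta> r h \<noteq> \<beta> s h" if "r \<in> ?F" "s \<in> ?F" "r \<noteq> s" for r s
    using that \<Phi>(3,4) by (auto simp: \<beta>_def) metis
  have ind: "independent (B r)" "finite (B r)" if "r \<in> ?F" for r
    using that x C by (auto simp: B_def)
  have "finite ?F" using \<Phi>(1) by simp
  note iB = independent_weight_vectors[where B = B and \<beta> = \<beta>, OF H_subset this ind(2) BR ind(1) dist]
  let ?B = "\<Union>r\<in>?F. B r"
  have "L = span ?B"
  proof
    have "?B \<subseteq> L" using BR root_space_subset by blast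
    then show "span ?B \<subseteq> L" by (rule span_minimal[OF _ subspace_L])
    have "root_space H \<delta> \<subseteq> span ?B" for \<delta>
    proof (cases "is_root H \<delta>")
      case True
      with \<Phi>(5) obtain r where r: "r \<in> \<Phi>" "\<forall>h\<in>H. \<delta> h = \<gamma> r h" by blast
      then have "root_space H \<delta> = span (B (Some r))"
        using x root_space_cong[of H \<delta> "\<gamma> r"] by (simp add: B_def)
      also have "\<dots> \<subseteq> span ?B" using r(1) by (intro span_mono) blast
      finally show ?thesis .
    next
      case False
      then consider "root_space H \<delta> = {0}" | "\<forall>h\<in>H. \<delta> h = 0" by (auto simp: is_root_def)
      then show ?thesis
      proof cases
        case 1
        then show ?thesis using span_zero by auto
      next
        case 2
        then have "root_space H \<delta> = H" using root_space_cong[of H \<delta> "\<lambda>_. 0"] zero_root_space by simp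
        also have "\<dots> \<subseteq> span (B None)" using C(4) by (simp add: B_def)
        also have "\<dots> \<subseteq> span ?B" by (intro span_mono) blast
        finally show ?thesis .
      qed
    qed
    then have "span (\<Union>\<delta>. root_space H \<delta>) \<subseteq> span ?B" by (intro span_minimal) auto
    then show "L \<subseteq> span ?B" using root_space_decomposition[OF fd cartan] by blast
  qed
  then have "dim L = card ?B" using iB(1) dim_span_eq_card_independent by simp
  also have "\<dots> = (\<Sum>r\<in>?F. card (B r))" by (rule iB(2))
  also have "\<dots> = card C + (\<Sum>r\<in>Some ` \<Phi>. card (B r))"
    using \<Phi>(1) by (subst sum.insert) (auto simp: B_def)
  also have "(\<Sum>r\<in>Some ` \<Phi>. card (B r)) = card \<Phi>"
    by (subst sum.reindex) (auto simp: B_def)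
  finally show ?thesis .
qed

end

section \<open>Root systems of rank one and two\<close>

text \<open>The off-diagonal entries of the Cartan matrix are \<open>-p\<close> and \<open>-q\<close>, so its determinant is \<open>4 - p * q\<close>.\<close>

locale rank2_lie_algebra = based_lie_algebra scale L br H 2 \<alpha> e f
  for scale :: "complex \<Rightarrow> 'a::ab_group_add \<Rightarrow> 'a" and L br H \<alpha> e f +
  fixes p q :: int
  assumes cartan01: "\<alpha> 1 (coroot 0) = - of_int p" and cartan10: "\<alpha> 0 (coroot 1) = - of_int q"
    and det_nonzero: "p * q \<noteq> 4"
begin

definition wt :: "int \<Rightarrow> int \<Rightarrow> 'a \<Rightarrow> complex" where
  "wt a b = (\<lambda>h. of_int a * \<alpha> 0 h + of_int b * \<alpha> 1 h)"

abbreviation wt_space :: "int \<Rightarrow> int \<Rightarrow> 'a set" where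
  "wt_space a b \<equiv> root_space H (wt a b)"

lemma wt_coroot: "wt a b (coroot 0) = of_int (2 * a - p * b)" "wt a b (coroot 1) = of_int (2 * b - q * a)"
  using cartan01 cartan10 coroot_2[of 0] coroot_2[of 1] by (simp_all add: wt_def)

text \<open>The simple reflections in coordinates with respect to the base.\<close>

lemma reflect_wt:
  "(\<lambda>h. wt a b h - of_int (2 * a - p * b) * \<alpha> 0 h) = wt (p * b - a) b"
  "(\<lambda>h. wt a b h - of_int (2 * b - q * a) * \<alpha> 1 h) = wt a (q * a - b)"
  by (auto simp: wt_def fun_eq_iff algebra_simps)

lemma one_less_2: "(1::nat) < 2" by simp

lemma reflect_nonzero:
  assumes "wt_space a b \<noteq> {0}"
  shows "wt_space (p * b - a) b \<noteq> {0}" and "wt_space a (q * a - b) \<noteq> {0}"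
  using reflection_nonzero[OF zero_less_numeral assms wt_coroot(1)]
    reflection_nonzero[OF one_less_2 assms wt_coroot(2)]
  by (simp_all only: reflect_wt not_False_eq_True)

lemma reflect_one_dim:
  assumes "one_dim (wt_space a b)"
  shows "one_dim (wt_space (p * b - a) b)" and "one_dim (wt_space a (q * a - b))"
  using reflection_one_dim[OF zero_less_numeral assms wt_coroot(1)]
    reflection_one_dim[OF one_less_2 assms wt_coroot(2)]
  by (simp_all only: reflect_wt not_False_eq_True)

lemma simple_wt_one_dim: "one_dim (wt_space 1 0)" "one_dim (wt_space 0 1)"
  using simple_root_one_dim[of 0] simple_root_one_dim[of 1] by (simp_all add: wt_def)

lemma lessThan_2: "{..<2::nat} = {0, 1}" by auto

lemma wt_inject:
  assumes "\<forall>h\<in>H. wt a b h = wt a' b' h"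
  shows "a = a' \<and> b = b'"
proof -
  let ?c = "\<lambda>i::nat. if i = 0 then complex_of_int (a - a') else of_int (b - b')"
  have "\<forall>c. (\<forall>h\<in>H. (\<Sum>i<2. c i * \<alpha> i h) = 0) \<longrightarrow> (\<forall>i<2. c i = 0)"
    using base unfolding is_base_def by (elim conjE)
  note ind = this[rule_format, of ?c]
  have "(\<Sum>i<2. ?c i * \<alpha> i h) = 0" if "h \<in> H" for h
    using assms that by (auto simp: lessThan_2 wt_def algebra_simps)
  from ind[OF this, of 0] ind[OF this, of 1] show ?thesis by simp
qed

lemma is_root_wt:
  assumes "is_root H \<beta>"
  obtains a b where "\<forall>h\<in>H. \<beta> h = wt a b h" "wt_space a b \<noteq> {0}" "(a, b) \<noteq> (0, 0)"
    "0 \<le> a \<and> 0 \<le> b \<or> a \<le> 0 \<and> b \<le> 0"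
proof -
  from assms base obtain c :: "nat \<Rightarrow> nat" where c: "(\<forall>h\<in>H. \<beta> h = (\<Sum>i<2. of_nat (c i) * \<alpha> i h)) \<or>
      (\<forall>h\<in>H. \<beta> h = - (\<Sum>i<2. of_nat (c i) * \<alpha> i h))"
    unfolding is_base_def by blast
  obtain a b where ab: "\<forall>h\<in>H. \<beta> h = wt a b h" "0 \<le> a \<and> 0 \<le> b \<or> a \<le> 0 \<and> b \<le> 0"
  proof (cases "\<forall>h\<in>H. \<beta> h = (\<Sum>i<2. of_nat (c i) * \<alpha> i h)")
    case True
    then show ?thesis using that[of "int (c 0)" "int (c 1)"] by (auto simp: lessThan_2 wt_def)
  next
    case False
    with c have "\<forall>h\<in>H. \<beta> h = - (\<Sum>i<2. of_nat (c i) * \<alpha> i h)" by blast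
    then show ?thesis using that[of "- int (c 0)" "- int (c 1)"] by (auto simp: lessThan_2 wt_def)
  qed
  moreover have "wt_space a b \<noteq> {0}"
    using assms root_space_cong[of H \<beta> "wt a b"] ab(1) by (auto simp: is_root_def)
  moreover have "(a, b) \<noteq> (0, 0)" using assms ab(1) by (auto simp: is_root_def wt_def)
  ultimately show ?thesis using that by blast
qed

lemma wt_space_same_sign:
  assumes "wt_space a b \<noteq> {0}"
  shows "0 \<le> a \<and> 0 \<le> b \<or> a \<le> 0 \<and> b \<le> 0"
proof (cases "\<exists>h\<in>H. wt a b h \<noteq> 0")
  case True
  with assms have "is_root H (wt a b)" by (simp add: is_root_def)
  then obtain a' b' where ab': "\<forall>h\<in>H. wt a b h = wt a' b' h" "0 \<le> a' \<and> 0 \<le> b' \<or> a' \<le> 0 \<and> b' \<le> 0"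
    by (rule is_root_wt)
  from wt_inject[OF ab'(1)] ab'(2) show ?thesis by simp
next
  case False
  then have "\<forall>h\<in>H. wt a b h = wt 0 0 h" by (auto simp: wt_def)
  from wt_inject[OF this] show ?thesis by simp
qed

lemma wt_space_axis:
  assumes "wt_space a b \<noteq> {0}"
  shows "b = 0 \<Longrightarrow> \<bar>a\<bar> \<le> 1" and "a = 0 \<Longrightarrow> \<bar>b\<bar> \<le> 1"
proof -
  have pos0: "k \<le> 1" if "wt_space k 0 \<noteq> {0}" for k
  proof (rule ccontr)
    assume "\<not> k \<le> 1"
    then have "wt_space k 0 = {0}" using multiple_not_root[of 0 "nat k"] by (simp add: wt_def)
    with that show False by simp
  qed
  have pos1: "k \<le> 1" if "wt_space 0 k \<noteq> {0}" for k
  proof (rule ccontr)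
    assume "\<not> k \<le> 1"
    then have "wt_space 0 k = {0}" using multiple_not_root[of 1 "nat k"] by (simp add: wt_def)
    with that show False by simp
  qed
  show "\<bar>a\<bar> \<le> 1" if "b = 0" using pos0[of a] pos0[of "- a"] reflect_nonzero(1)[OF assms] assms that by auto
  show "\<bar>b\<bar> \<le> 1" if "a = 0" using pos1[of b] pos1[of "- b"] reflect_nonzero(2)[OF assms] assms that by auto
qed

text \<open>By \<open>simple_roots_separate\<close> an element of \<open>H\<close> is determined by its values at the two simple roots, and
  coefficients with prescribed values are found by Cramer's rule, with \<open>d\<close> the determinant of the Cartan matrix.\<close>

lemma coroots_basis:
  "independent {coroot 0, coroot 1}" "card {coroot 0, coroot 1} = 2" "H \<subseteq> span {coroot 0, coroot 1}"
proof -
  define d where "d = 4 - complex_of_int p * of_int q"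
  have d: "d \<noteq> 0" unfolding d_def using det_nonzero
    by (metis eq_iff_diff_eq_0 of_int_eq_iff of_int_mult of_int_numeral)
  have in_H: "coroot 0 \<in> H" "coroot 1 \<in> H" using coroot_in_H by simp_all
  have comb: "\<alpha> i (scale x (coroot 0) + scale y (coroot 1)) = x * \<alpha> i (coroot 0) + y * \<alpha> i (coroot 1)"
    if "i < 2" for i x y
    using in_H subspace_scale[OF subspace_H] root_add[OF simple_root_nonzero[OF that]]
      root_scale[OF simple_root_nonzero[OF that]] by simp
  note vals = cartan01 cartan10 coroot_2[of 0, simplified] coroot_2[of 1, simplified]
  have zero: "x = 0 \<and> y = 0" if "scale x (coroot 0) + scale y (coroot 1) = 0" for x y
  proof -
    have "\<alpha> i 0 = 0" if "i < 2" for i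
      using root_scale[OF simple_root_nonzero[OF that] in_H(1), of 0] by simp
    then have 1: "2 * x - of_int q * y = 0" and 2: "2 * y - of_int p * x = 0"
      using comb[of 0 x y] comb[of 1 x y] that vals by (simp_all add: algebra_simps)
    have "d * x = 2 * (2 * x - of_int q * y) + of_int q * (2 * y - of_int p * x)"
      "d * y = 2 * (2 * y - of_int p * x) + of_int p * (2 * x - of_int q * y)"
      by (simp_all add: d_def algebra_simps)
    then show ?thesis using d unfolding 1 2 by simp
  qed
  have ne: "coroot 0 \<noteq> coroot 1" using zero[of 1 "- 1"] by auto
  show "card {coroot 0, coroot 1} = 2" using ne by simp
  show "independent {coroot 0, coroot 1}"
    using ne zero by (intro independent_if_scalars_zero) auto
  show "H \<subseteq> span {coroot 0, coroot 1}"
  proof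
    fix h assume h: "h \<in> H"
    define x where "x = (2 * \<alpha> 0 h + of_int q * \<alpha> 1 h) / d"
    define y where "y = (2 * \<alpha> 1 h + of_int p * \<alpha> 0 h) / d"
    let ?k = "scale x (coroot 0) + scale y (coroot 1)"
    have k: "?k \<in> H" using in_H subspace_H by (intro subspace_add subspace_scale)
    have xy: "d * x = 2 * \<alpha> 0 h + of_int q * \<alpha> 1 h" "d * y = 2 * \<alpha> 1 h + of_int p * \<alpha> 0 h"
      using d by (simp_all add: x_def y_def)
    have "d * (2 * x - of_int q * y) = 2 * (d * x) - of_int q * (d * y)"
      "d * (2 * y - of_int p * x) = 2 * (d * y) - of_int p * (d * x)" by (simp_all add: algebra_simps)
    then have "d * (2 * x - of_int q * y) = d * \<alpha> 0 h" "d * (2 * y - of_int p * x) = d * \<alpha> 1 h"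
      unfolding xy by (simp_all add: d_def algebra_simps)
    then have "2 * x - of_int q * y = \<alpha> 0 h" "2 * y - of_int p * x = \<alpha> 1 h"
      using d by simp_all
    then have "\<alpha> 0 ?k = \<alpha> 0 h" "\<alpha> 1 ?k = \<alpha> 1 h"
      using comb[of 0 x y] comb[of 1 x y] vals by (simp_all add: algebra_simps)
    then have "\<alpha> i (h - ?k) = 0" if "i < 2" for i
      using root_diff[OF simple_root_nonzero[OF that] h k] that less_2_cases[OF that] by auto
    then have "h - ?k = 0" using simple_roots_separate subspace_diff[OF subspace_H h k] by blast
    then have "h = ?k" by simp
    then show "h \<in> span {coroot 0, coroot 1}"
      by (simp only:) (intro span_add span_scale span_base; simp)
  qed
qed

lemma dim_rank2:
  assumes "finite \<Phi>" "(0, 0) \<notin> \<Phi>" "\<And>a b. (a, b) \<in> \<Phi> \<Longrightarrow> one_dim (wt_space a b)"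
    and "\<And>a b. wt_space a b \<noteq> {0} \<Longrightarrow> (a, b) \<noteq> (0, 0) \<Longrightarrow> (a, b) \<in> \<Phi>"
  shows "dim L = 2 + card \<Phi>"
proof -
  have inj: "\<exists>h\<in>H. wt a b h \<noteq> wt a' b' h" if "(a, b) \<noteq> (a', b')" for a b a' b'
    using wt_inject[of a b a' b'] that by auto
  have "dim L = card {coroot 0, coroot 1} + card \<Phi>"
  proof (rule dim_from_roots[where \<gamma> = "\<lambda>(a, b). wt a b"])
    show "\<exists>h\<in>H. (case r of (a, b) \<Rightarrow> wt a b) h \<noteq> 0" if "r \<in> \<Phi>" for r
      using inj[of "fst r" "snd r" 0 0] that assms(2) by (cases r) (auto simp: wt_def)
    show "\<exists>h\<in>H. (case r of (a, b) \<Rightarrow> wt a b) h \<noteq> (case s of (a, b) \<Rightarrow> wt a b) h"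
      if "r \<noteq> s" for r s
      using inj[of "fst r" "snd r" "fst s" "snd s"] that by (auto split: prod.splits)
    show "\<exists>r\<in>\<Phi>. \<forall>h\<in>H. \<beta> h = (case r of (a, b) \<Rightarrow> wt a b) h" if "is_root H \<beta>" for \<beta>
    proof -
      from that obtain a b where "\<forall>h\<in>H. \<beta> h = wt a b h" "wt_space a b \<noteq> {0}" "(a, b) \<noteq> (0, 0)"
        by (rule is_root_wt)
      with assms(4)[of a b] show ?thesis by (intro bexI[of _ "(a, b)"]) auto
    qed
    show "one_dim (root_space H (case r of (a, b) \<Rightarrow> wt a b))" if "r \<in> \<Phi>" for r
      using that assms(3)[of "fst r" "snd r"] by (cases r) simp
  qed (use assms(1) coroots_basis(1,3) coroot_in_H in simp_all)
  then show ?thesis using coroots_basis(2) by simp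
qed

end

text \<open>The list of roots is invariant under both reflections.  If \<open>a\<close> and \<open>b\<close> are nonzero, one of the reflections makes
  its coordinate smaller in absolute value, since the reflected coefficients may not have opposite signs; so the
  descent ends on a coordinate axis, where only \<open>\<plusminus>1\<close> is possible.\<close>

lemma (in rank2_lie_algebra) dim_A2:
  assumes pq: "p = 1" "q = 1"
  shows "dim L = 8"
proof -
  let ?\<Phi> = "{(1,0), (0,1), (1,1), (-1,0), (0,-1), (-1,-1)} :: (int \<times> int) set"
  note r0 = reflect_one_dim(1)[unfolded pq] and r1 = reflect_one_dim(2)[unfolded pq]
  have one: "one_dim (wt_space 1 0)" "one_dim (wt_space 0 1)"
    "one_dim (wt_space 1 1)" "one_dim (wt_space (-1) 0)" "one_dim (wt_space 0 (-1))"
    using simple_wt_one_dim r0[of 0 1] r0[of 1 0] r1[of 0 1] by simp_all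
  have one': "one_dim (wt_space (-1) (-1))" using r0[of 0 "-1"] one by simp
  have roots: "(a, b) \<in> insert (0, 0) ?\<Phi>" if "wt_space a b \<noteq> {0}" for a b
    using that
  proof (induction "nat (\<bar>a\<bar> + \<bar>b\<bar>)" arbitrary: a b rule: less_induct)
    case less
    note s = wt_space_same_sign[OF less.prems] and ax = wt_space_axis[OF less.prems]
    note nz = reflect_nonzero[OF less.prems, unfolded pq]
    note s0 = wt_space_same_sign[OF nz(1)] and s1 = wt_space_same_sign[OF nz(2)]
    note IH0 = less.hyps[OF _ nz(1)] and IH1 = less.hyps[OF _ nz(2)]
    consider "a = 0" | "b = 0" | "\<bar>1 * b - a\<bar> < \<bar>a\<bar>" "b \<noteq> 0" | "\<bar>1 * a - b\<bar> < \<bar>b\<bar>" "a \<noteq> 0"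
      using s s0 s1 by linarith
    then show ?case
    proof cases
      case 1
      with ax(2) have "b = - 1 \<or> b = 0 \<or> b = 1" by linarith
      with 1 show ?thesis by auto
    next
      case 2
      with ax(1) have "a = - 1 \<or> a = 0 \<or> a = 1" by linarith
      with 2 show ?thesis by auto
    next
      case 3
      define x where "x = 1 * b - a"
      have a: "a = b - x" by (simp add: x_def)
      have "(x, b) \<in> insert (0, 0) ?\<Phi>" unfolding x_def by (rule IH0) (use 3 in simp)
      then show ?thesis unfolding a insert_iff prod.inject empty_iff
        by (elim disjE conjE FalseE) simp_all
    next
      case 4
      define y where "y = 1 * a - b"
      have b: "b = 1 * a - y" by (simp add: y_def)
      have "(a, y) \<in> insert (0, 0) ?\<Phi>" unfolding y_def by (rule IH1) (use 4 in simp)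
      then show ?thesis unfolding b insert_iff prod.inject empty_iff
        by (elim disjE conjE FalseE) simp_all
    qed
  qed
  have "dim L = 2 + card ?\<Phi>"
  proof (rule dim_rank2)
    show "one_dim (wt_space a b)" if "(a, b) \<in> ?\<Phi>" for a b
      using that one one' unfolding insert_iff prod.inject empty_iff by (elim disjE conjE FalseE) (simp_all only:)
    show "(a, b) \<in> ?\<Phi>" if "wt_space a b \<noteq> {0}" "(a, b) \<noteq> (0, 0)" for a b
      by (rule insertE[OF roots[OF that(1)]]) (erule notE[OF that(2)], assumption)
  qed simp_all
  then show ?thesis by simp
qed

text \<open>The descent is the one for type A2, with the first coordinate reflected to \<open>b - a\<close> and the second to
  \<open>3a - b\<close>.  The twelve roots form the reflection orbits of the two simple roots.\<close>

lemma (in rank2_lie_algebra) dim_G2: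
  assumes pq: "p = 1" "q = 3"
  shows "dim L = 14"
proof -
  let ?\<Phi> = "{(1,0), (0,1), (1,1), (1,2), (1,3), (2,3),
    (-1,0), (0,-1), (-1,-1), (-1,-2), (-1,-3), (-2,-3)} :: (int \<times> int) set"
  note r0 = reflect_one_dim(1)[unfolded pq] and r1 = reflect_one_dim(2)[unfolded pq]
  have 1: "one_dim (wt_space 1 0)" "one_dim (wt_space 0 1)" by (rule simple_wt_one_dim)+
  have 2: "one_dim (wt_space (-1) 0)" "one_dim (wt_space 1 3)" "one_dim (wt_space 1 1)"
    "one_dim (wt_space 0 (-1))"
    using r0[OF 1(1)] r1[OF 1(1)] r0[OF 1(2)] r1[OF 1(2)] by simp_all
  have 3: "one_dim (wt_space (-1) (-3))" "one_dim (wt_space 2 3)" "one_dim (wt_space 1 2)"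
    "one_dim (wt_space (-1) (-1))"
    using r1[OF 2(1)] r0[OF 2(2)] r1[OF 2(3)] r0[OF 2(4)] by simp_all
  have 4: "one_dim (wt_space (-2) (-3))" "one_dim (wt_space (-1) (-2))"
    using r0[OF 3(1)] r1[OF 3(4)] by simp_all
  have roots: "(a, b) \<in> insert (0, 0) ?\<Phi>" if "wt_space a b \<noteq> {0}" for a b
    using that
  proof (induction "nat (\<bar>a\<bar> + \<bar>b\<bar>)" arbitrary: a b rule: less_induct)
    case less
    note s = wt_space_same_sign[OF less.prems] and ax = wt_space_axis[OF less.prems]
    note nz = reflect_nonzero[OF less.prems, unfolded pq]
    note s0 = wt_space_same_sign[OF nz(1)] and s1 = wt_space_same_sign[OF nz(2)]
    note IH0 = less.hyps[OF _ nz(1)] and IH1 = less.hyps[OF _ nz(2)]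
    consider "a = 0" | "b = 0" | "\<bar>1 * b - a\<bar> < \<bar>a\<bar>" "b \<noteq> 0" | "\<bar>3 * a - b\<bar> < \<bar>b\<bar>" "a \<noteq> 0"
      using s s0 s1 by linarith
    then show ?case
    proof cases
      case 1
      with ax(2) have "b = - 1 \<or> b = 0 \<or> b = 1" by linarith
      with 1 show ?thesis by auto
    next
      case 2
      with ax(1) have "a = - 1 \<or> a = 0 \<or> a = 1" by linarith
      with 2 show ?thesis by auto
    next
      case 3
      define x where "x = 1 * b - a"
      have a: "a = b - x" by (simp add: x_def)
      have "(x, b) \<in> insert (0, 0) ?\<Phi>" unfolding x_def by (rule IH0) (use 3 in simp)
      then show ?thesis unfolding a insert_iff prod.inject empty_iff
        by (elim disjE conjE FalseE) simp_all
    next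
      case 4
      define y where "y = 3 * a - b"
      have b: "b = 3 * a - y" by (simp add: y_def)
      have "(a, y) \<in> insert (0, 0) ?\<Phi>" unfolding y_def by (rule IH1) (use 4 in simp)
      then show ?thesis unfolding b insert_iff prod.inject empty_iff
        by (elim disjE conjE FalseE) simp_all
    qed
  qed
  have "dim L = 2 + card ?\<Phi>"
  proof (rule dim_rank2)
    show "one_dim (wt_space a b)" if "(a, b) \<in> ?\<Phi>" for a b
      using that 1 2 3 4 unfolding insert_iff prod.inject empty_iff by (elim disjE conjE FalseE) (simp_all only:)
    show "(a, b) \<in> ?\<Phi>" if "wt_space a b \<noteq> {0}" "(a, b) \<noteq> (0, 0)" for a b
      by (rule insertE[OF roots[OF that(1)]]) (erule notE[OF that(2)], assumption)
  qed simp_all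
  then show ?thesis by simp
qed

text \<open>In rank one all roots are multiples of a single \<open>\<alpha>\<close>.  Proper positive multiples are excluded by
  \<open>multiple_not_root\<close>, the negative ones by reflecting them.\<close>

lemma (in based_lie_algebra) dim_A1:
  assumes n: "n = 1"
  shows "dim L = 3"
proof -
  have in_H: "coroot 0 \<in> H" using coroot_in_H n by simp
  have a2: "\<alpha> 0 (coroot 0) = 2" using coroot_2 n by simp
  note nz = simple_root_nonzero[of 0, unfolded n, simplified]
  have c0: "coroot 0 \<noteq> 0" using a2 root_scale[OF nz in_H, of 0] by auto
  have H: "H \<subseteq> span {coroot 0}"
  proof
    fix h assume h: "h \<in> H"
    let ?k = "scale (\<alpha> 0 h / 2) (coroot 0)"
    have k: "?k \<in> H" using in_H subspace_H by (intro subspace_scale)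
    have "\<alpha> 0 (h - ?k) = 0" using root_diff[OF nz h k] root_scale[OF nz in_H] a2 by simp
    then have "h - ?k = 0" using simple_roots_separate[OF subspace_diff[OF subspace_H h k]] n by simp
    then show "h \<in> span {coroot 0}" by (auto simp: span_singleton)
  qed
  define \<gamma> where "\<gamma> s = (\<lambda>h. of_int s * \<alpha> 0 h)" for s :: int
  have 1: "one_dim (root_space H (\<gamma> 1))" using simple_root_one_dim n by (simp add: \<gamma>_def)
  have "one_dim (root_space H (\<lambda>h. \<gamma> 1 h - of_int 2 * \<alpha> 0 h))"
    by (rule reflection_one_dim[OF _ 1]) (simp_all add: n \<gamma>_def a2)
  then have 2: "one_dim (root_space H (\<gamma> (- 1)))" by (simp add: \<gamma>_def)
  have mult: "k \<le> 1" if "root_space H (\<gamma> k) \<noteq> {0}" for k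
  proof (rule ccontr)
    assume "\<not> k \<le> 1"
    then have "root_space H (\<gamma> k) = {0}" using multiple_not_root[of 0 "nat k"] n by (simp add: \<gamma>_def)
    with that show False by simp
  qed
  have "dim L = card {coroot 0} + card {1, - 1 :: int}"
  proof (rule dim_from_roots[where \<gamma> = \<gamma>])
    fix r s :: int assume r: "r \<in> {1, - 1}"
    then show "one_dim (root_space H (\<gamma> r))" using 1 2 by auto
    show "\<exists>h\<in>H. \<gamma> r h \<noteq> 0" using r in_H a2 by (intro bexI[of _ "coroot 0"]) (auto simp: \<gamma>_def)
    show "\<exists>h\<in>H. \<gamma> r h \<noteq> \<gamma> s h" if "r \<noteq> s"
      using that in_H a2 by (intro bexI[of _ "coroot 0"]) (auto simp: \<gamma>_def)
  next
    fix \<beta> assume \<beta>: "is_root H \<beta>"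
    with base n obtain c :: "nat \<Rightarrow> nat" where c: "(\<forall>h\<in>H. \<beta> h = of_nat (c 0) * \<alpha> 0 h) \<or>
      (\<forall>h\<in>H. \<beta> h = - (of_nat (c 0) * \<alpha> 0 h))"
      unfolding is_base_def by fastforce
    then obtain k where k: "\<forall>h\<in>H. \<beta> h = \<gamma> k h"
      by (metis \<gamma>_def mult_minus_left of_int_minus of_int_of_nat_eq)
    have Rk: "root_space H (\<gamma> k) \<noteq> {0}" using \<beta> root_space_cong[of H \<beta> "\<gamma> k"] k by (auto simp: is_root_def)
    have "root_space H (\<lambda>h. \<gamma> k h - of_int (2 * k) * \<alpha> 0 h) \<noteq> {0}"
      using Rk by (rule reflection_nonzero[rotated]) (simp_all add: n \<gamma>_def a2)
    then have "root_space H (\<gamma> (- k)) \<noteq> {0}" by (simp add: \<gamma>_def algebra_simps)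
    from mult[OF this] mult[OF Rk] have "\<bar>k\<bar> \<le> 1" by simp
    moreover have "k \<noteq> 0" using \<beta> k by (auto simp: is_root_def \<gamma>_def)
    ultimately have "k \<in> {1, - 1}" by auto
    with k show "\<exists>r\<in>{1, - 1}. \<forall>h\<in>H. \<beta> h = \<gamma> r h" by blast
  qed (use H in_H c0 in simp_all)
  then show ?thesis by simp
qed

section \<open>Dimensions from the Cartan type\<close>

lemma based_lie_algebra_of_type:
  assumes "simple_lie_algebra_of_type T sc L br"
  obtains H \<alpha> e f where "based_lie_algebra sc L br H (dynkin_rank T) \<alpha> e f"
    "\<And>i j. i < dynkin_rank T \<Longrightarrow> j < dynkin_rank T \<Longrightarrow> \<alpha> j (br (e i) (f i)) = of_int (cartan_matrix T i j)"
proof -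
  interpret complex_lie_algebra sc L br
    using assms by (simp add: simple_lie_algebra_of_type_def)
  let ?n = "dynkin_rank T"
  from assms have fd: "finite_dim" and simple: "simple" and "has_cartan_matrix ?n (cartan_matrix T)"
    by (auto simp: simple_lie_algebra_of_type_def)
  then obtain H \<alpha> h where H: "cartan_subalgebra H" and base: "is_base H ?n \<alpha>"
    and coroot: "\<forall>i<?n. is_coroot H (\<alpha> i) (h i)"
    and A: "\<forall>i<?n. \<forall>j<?n. \<alpha> j (h i) = of_int (cartan_matrix T i j)"
    unfolding has_cartan_matrix_def by (elim exE conjE)
  from coroot have "\<forall>i. \<exists>x y. i < ?n \<longrightarrow> x \<in> root_space H (\<alpha> i) \<and> y \<in> root_space H (\<lambda>k. - \<alpha> i k)
      \<and> h i = br x y \<and> \<alpha> i (h i) = 2"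
    unfolding is_coroot_def by blast
  then obtain e f where ef: "\<And>i. i < ?n \<Longrightarrow> e i \<in> root_space H (\<alpha> i) \<and> f i \<in> root_space H (\<lambda>k. - \<alpha> i k)
      \<and> h i = br (e i) (f i) \<and> \<alpha> i (h i) = 2"
    by metis
  show ?thesis
  proof (rule that)
    show "based_lie_algebra sc L br H ?n \<alpha> e f"
    proof unfold_locales
      show "\<alpha> i (br (e i) (f i)) = 2" if "i < ?n" for i using ef[OF that] by metis
    qed (use fd simple H base ef in auto)
    show "\<alpha> j (br (e i) (f i)) = of_int (cartan_matrix T i j)" if "i < ?n" "j < ?n" for i j
      using A ef[OF that(1)] that by metis
  qed
qed

lemma dim_type_A1:
  assumes "simple_lie_algebra_of_type (Type_A 1) sc L br"
  shows "vector_space.dim sc L = 3"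
proof -
  obtain H \<alpha> e f where "based_lie_algebra sc L br H 1 \<alpha> e f"
    using based_lie_algebra_of_type[OF assms, unfolded dynkin_rank.simps] by metis
  then interpret based_lie_algebra sc L br H 1 \<alpha> e f .
  show ?thesis by (rule dim_A1) simp
qed

lemma dim_type_A2:
  assumes "simple_lie_algebra_of_type (Type_A 2) sc L br"
  shows "vector_space.dim sc L = 8"
proof -
  obtain H \<alpha> e f where B: "based_lie_algebra sc L br H 2 \<alpha> e f"
    and A: "\<And>i j. i < 2 \<Longrightarrow> j < 2 \<Longrightarrow> \<alpha> j (br (e i) (f i)) = of_int (cartan_matrix (Type_A 2) i j)"
    using based_lie_algebra_of_type[OF assms, unfolded dynkin_rank.simps] by metis
  interpret based_lie_algebra sc L br H 2 \<alpha> e f by (rule B)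
  interpret rank2_lie_algebra sc L br H \<alpha> e f 1 1
    using A[of 0 1] A[of 1 0] by unfold_locales simp_all
  show ?thesis by (rule dim_A2) simp_all
qed

lemma dim_type_G2:
  assumes "simple_lie_algebra_of_type Type_G2 sc L br"
  shows "vector_space.dim sc L = 14"
proof -
  obtain H \<alpha> e f where B: "based_lie_algebra sc L br H 2 \<alpha> e f"
    and A: "\<And>i j. i < 2 \<Longrightarrow> j < 2 \<Longrightarrow> \<alpha> j (br (e i) (f i)) = of_int (cartan_matrix Type_G2 i j)"
    using based_lie_algebra_of_type[OF assms, unfolded dynkin_rank.simps] by metis
  interpret based_lie_algebra sc L br H 2 \<alpha> e f by (rule B)
  interpret rank2_lie_algebra sc L br H \<alpha> e f 1 3
    using A[of 0 1] A[of 1 0] by unfold_locales simp_all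
  show ?thesis by (rule dim_G2) simp_all
qed

section \<open>A model of the Lie algebra of type G2\<close>

text \<open>An element \<open>(A, v, w)\<close> of \<open>sl(3) \<oplus> V \<oplus> V*\<close> is stored in the first 14 terms of a sequence: the diagonal entries
  \<open>A\<^sub>1\<^sub>1\<close>, \<open>A\<^sub>2\<^sub>2\<close>, the entries \<open>A\<^sub>1\<^sub>2, A\<^sub>1\<^sub>3, A\<^sub>2\<^sub>3, A\<^sub>2\<^sub>1, A\<^sub>3\<^sub>1, A\<^sub>3\<^sub>2\<close>, then \<open>v\<close>, then \<open>w\<close>.  The trace
  condition determines the last diagonal entry.  Each position from 2 on belongs to one root.\<close>

definition g2_mat :: "(nat \<Rightarrow> complex) \<Rightarrow> nat \<Rightarrow> nat \<Rightarrow> complex" where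
  "g2_mat x i j = [[x 0, x 2, x 3], [x 5, x 1, x 4], [x 6, x 7, - x 0 - x 1]] ! i ! j"

definition g2_tuple :: "(nat \<Rightarrow> nat \<Rightarrow> complex) \<Rightarrow> (nat \<Rightarrow> complex) \<Rightarrow> (nat \<Rightarrow> complex) \<Rightarrow> nat \<Rightarrow> complex" where
  "g2_tuple A v w n = (if n < 14 then
     [A 0 0, A 1 1, A 0 1, A 0 2, A 1 2, A 1 0, A 2 0, A 2 1, v 0, v 1, v 2, w 0, w 1, w 2] ! n else 0)"

definition cross :: "(nat \<Rightarrow> complex) \<Rightarrow> (nat \<Rightarrow> complex) \<Rightarrow> nat \<Rightarrow> complex" where
  "cross v w i = v ((i + 1) mod 3) * w ((i + 2) mod 3) - v ((i + 2) mod 3) * w ((i + 1) mod 3)"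

text \<open>The bracket of sl(3), its actions on \<open>V\<close> and \<open>V*\<close>, and
  \<open>[v, v'] = - 2 v \<times> v'\<close>, \<open>[w, w'] = 2 w \<times> w'\<close>, \<open>[v, w] = 3 v w\<^sup>T - (v \<cdot> w) I\<close>.
  In the Jacobi identity of \<open>v, v', w\<close> the terms in \<open>(w \<cdot> v') v\<close> have the coefficients \<open>-4, 1, 3\<close>; they cancel
  for this choice of the constants.\<close>

definition g2_bracket :: "(nat \<Rightarrow> complex) \<Rightarrow> (nat \<Rightarrow> complex) \<Rightarrow> (nat \<Rightarrow> complex)" where
  "g2_bracket x y = (let
      A = g2_mat x; v = \<lambda>i. x (8 + i); w = \<lambda>i. x (11 + i);
      B = g2_mat y; v' = \<lambda>i. y (8 + i); w' = \<lambda>i. y (11 + i)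
    in g2_tuple
      (\<lambda>i j. (\<Sum>k<3. A i k * B k j - B i k * A k j) + 3 * (v i * w' j - v' i * w j)
         - (if i = j then \<Sum>k<3. v k * w' k - v' k * w k else 0))
      (\<lambda>i. (\<Sum>k<3. A i k * v' k - B i k * v k) + 2 * cross w w' i)
      (\<lambda>i. - (\<Sum>k<3. A k i * w' k - B k i * w k) - 2 * cross v v' i))"

lemma sum_lessThan_3: "(\<Sum>k<3. f k) = f 0 + f 1 + (f (2 :: nat) :: complex)"
  by (simp add: eval_nat_numeral)

lemma g2_bracket_coords:
  "g2_bracket x y 0 = x 2 * y 5 - y 2 * x 5 + x 3 * y 6 - y 3 * x 6 + 2 * (x 8 * y 11 - y 8 * x 11)
     - (x 9 * y 12 - y 9 * x 12) - (x 10 * y 13 - y 10 * x 13)"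
  "g2_bracket x y 1 = x 5 * y 2 - y 5 * x 2 + x 4 * y 7 - y 4 * x 7 + 2 * (x 9 * y 12 - y 9 * x 12)
     - (x 8 * y 11 - y 8 * x 11) - (x 10 * y 13 - y 10 * x 13)"
  "g2_bracket x y 2 = (x 0 - x 1) * y 2 - (y 0 - y 1) * x 2 + x 3 * y 7 - y 3 * x 7 + 3 * (x 8 * y 12 - y 8 * x 12)"
  "g2_bracket x y 3 = (2 * x 0 + x 1) * y 3 - (2 * y 0 + y 1) * x 3 + x 2 * y 4 - y 2 * x 4 + 3 * (x 8 * y 13 - y 8 * x 13)"
  "g2_bracket x y 4 = (x 0 + 2 * x 1) * y 4 - (y 0 + 2 * y 1) * x 4 + x 5 * y 3 - y 5 * x 3 + 3 * (x 9 * y 13 - y 9 * x 13)"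
  "g2_bracket x y 5 = (x 1 - x 0) * y 5 - (y 1 - y 0) * x 5 + x 4 * y 6 - y 4 * x 6 + 3 * (x 9 * y 11 - y 9 * x 11)"
  "g2_bracket x y 6 = - (2 * x 0 + x 1) * y 6 + (2 * y 0 + y 1) * x 6 + x 7 * y 5 - y 7 * x 5 + 3 * (x 10 * y 11 - y 10 * x 11)"
  "g2_bracket x y 7 = - (x 0 + 2 * x 1) * y 7 + (y 0 + 2 * y 1) * x 7 + x 6 * y 2 - y 6 * x 2 + 3 * (x 10 * y 12 - y 10 * x 12)"
  "g2_bracket x y 8 = x 0 * y 8 - y 0 * x 8 + x 2 * y 9 - y 2 * x 9 + x 3 * y 10 - y 3 * x 10 + 2 * (x 12 * y 13 - x 13 * y 12)"
  "g2_bracket x y 9 = x 1 * y 9 - y 1 * x 9 + x 5 * y 8 - y 5 * x 8 + x 4 * y 10 - y 4 * x 10 + 2 * (x 13 * y 11 - x 11 * y 13)"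
  "g2_bracket x y 10 = - (x 0 + x 1) * y 10 + (y 0 + y 1) * x 10 + x 6 * y 8 - y 6 * x 8 + x 7 * y 9 - y 7 * x 9 + 2 * (x 11 * y 12 - x 12 * y 11)"
  "g2_bracket x y 11 = - x 0 * y 11 + y 0 * x 11 - x 5 * y 12 + y 5 * x 12 - x 6 * y 13 + y 6 * x 13 - 2 * (x 9 * y 10 - x 10 * y 9)"
  "g2_bracket x y 12 = - x 1 * y 12 + y 1 * x 12 - x 2 * y 11 + y 2 * x 11 - x 7 * y 13 + y 7 * x 13 - 2 * (x 10 * y 8 - x 8 * y 10)"
  "g2_bracket x y 13 = (x 0 + x 1) * y 13 - (y 0 + y 1) * x 13 - x 3 * y 11 + y 3 * x 11 - x 4 * y 12 + y 4 * x 12 - 2 * (x 8 * y 9 - x 9 * y 8)"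
  by (simp_all add: g2_bracket_def Let_def g2_tuple_def g2_mat_def cross_def sum_lessThan_3 algebra_simps)

lemma g2_bracket_beyond: "n \<ge> 14 \<Longrightarrow> g2_bracket x y n = 0"
  by (simp add: g2_bracket_def Let_def g2_tuple_def)

lemma less_14_cases:
  assumes "n < 14"
  shows "n \<in> {0, 1, 2, 3, 4, 5, 6, 7, 8, 9, 10, 11, 12, 13 :: nat}"
  using assms unfolding insert_iff empty_iff by presburger

lemma g2_ext:
  fixes x y :: "nat \<Rightarrow> complex"
  assumes "x 0 = y 0" "x 1 = y 1" "x 2 = y 2" "x 3 = y 3" "x 4 = y 4" "x 5 = y 5" "x 6 = y 6" "x 7 = y 7"
    "x 8 = y 8" "x 9 = y 9" "x 10 = y 10" "x 11 = y 11" "x 12 = y 12" "x 13 = y 13"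
    and "\<And>n. n \<ge> 14 \<Longrightarrow> x n = y n"
  shows "x = y"
proof
  fix n
  show "x n = y n"
  proof (cases "n < 14")
    case True
    from less_14_cases[OF this] show ?thesis
      unfolding insert_iff empty_iff by (elim disjE FalseE) (simp_all only: assms)
  next
    case False
    then show ?thesis using assms(15) by simp
  qed
qed

lemma g2_bracket_add_left: "g2_bracket (x + y) z = g2_bracket x z + g2_bracket y z"
  by (rule g2_ext) (simp_all only: plus_fun_apply g2_bracket_coords g2_bracket_beyond, simp_all add: algebra_simps)

lemma g2_bracket_scale_left: "g2_bracket (seq_scale c x) y = seq_scale c (g2_bracket x y)"
  by (rule g2_ext) (simp_all only: seq_scale_def g2_bracket_coords g2_bracket_beyond, simp_all add: algebra_simps)

lemma g2_bracket_antisym: "g2_bracket x y = - g2_bracket y x"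
  by (rule g2_ext) (simp_all only: fun_Compl_def g2_bracket_coords g2_bracket_beyond, simp_all add: algebra_simps)

lemma g2_bracket_self: "g2_bracket x x = 0"
  by (rule g2_ext) (simp_all only: zero_fun_apply g2_bracket_coords g2_bracket_beyond, simp_all add: algebra_simps)

text \<open>Coordinate by coordinate this is a polynomial identity in 42 variables.\<close>

lemma g2_bracket_jacobi:
  "g2_bracket x (g2_bracket y z) + g2_bracket y (g2_bracket z x) + g2_bracket z (g2_bracket x y) = 0"
proof (rule g2_ext)
  fix n :: nat
  assume "14 \<le> n"
  then show "(g2_bracket x (g2_bracket y z) + g2_bracket y (g2_bracket z x) + g2_bracket z (g2_bracket x y)) n
      = (0 :: nat \<Rightarrow> complex) n"
    by (simp add: g2_bracket_beyond)
qed (unfold plus_fun_apply zero_fun_apply g2_bracket_coords, algebra+)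

section \<open>Subalgebras of the model spanned by root vectors\<close>

definition g2_unit :: "nat \<Rightarrow> nat \<Rightarrow> complex" where
  "g2_unit k = (\<lambda>n. if n = k then 1 else 0)"

text \<open>The eigenvalue of a diagonal matrix, given by its entries \<open>h 0\<close> and \<open>h 1\<close>, on the unit vector of each position.\<close>

definition g2_weight :: "(nat \<Rightarrow> complex) \<Rightarrow> nat \<Rightarrow> complex" where
  "g2_weight h i = [0, 0, h 0 - h 1, 2 * h 0 + h 1, h 0 + 2 * h 1, h 1 - h 0, - (2 * h 0 + h 1),
     - (h 0 + 2 * h 1), h 0, h 1, - (h 0 + h 1), - h 0, - h 1, h 0 + h 1] ! i"

text \<open>The span of the root vectors with positions in \<open>R\<close> and of a space of diagonal matrices: all traceless ones if \<open>full\<close>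
  holds, and otherwise the multiples of \<open>diag(1, -1, 0)\<close>.\<close>

definition g2_sub :: "nat set \<Rightarrow> bool \<Rightarrow> (nat \<Rightarrow> complex) set" where
  "g2_sub R full = {x. (\<forall>n. n \<notin> R \<union> {0, 1} \<longrightarrow> x n = 0) \<and> (full \<or> x 0 + x 1 = 0)}"

lemma vector_space_seq_scale: "vector_space seq_scale"
  by unfold_locales (auto simp: seq_scale_def fun_eq_iff algebra_simps)

interpretation seq: vector_space seq_scale
  by (rule vector_space_seq_scale)

lemma g2_weight_bracket:
  assumes "\<And>n. n \<ge> 2 \<Longrightarrow> h n = 0" "\<And>n. n \<ge> 14 \<Longrightarrow> x n = 0"
  shows "g2_bracket h x = (\<lambda>n. g2_weight h n * x n)"
proof -
  have h: "h 2 = 0" "h 3 = 0" "h 4 = 0" "h 5 = 0" "h 6 = 0" "h 7 = 0" "h 8 = 0" "h 9 = 0" "h 10 = 0"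
    "h 11 = 0" "h 12 = 0" "h 13 = 0"
    by (rule assms(1), simp)+
  show ?thesis
  proof (rule g2_ext)
    fix n :: nat
    assume "14 \<le> n"
    then show "g2_bracket h x n = g2_weight h n * x n" using assms(2) g2_bracket_beyond by simp
  qed (unfold g2_bracket_coords g2_weight_def h, simp_all)
qed

lemma subspace_g2_sub: "seq.subspace (g2_sub R full)"
  unfolding seq.subspace_def
proof (intro conjI ballI allI)
  show "0 \<in> g2_sub R full" by (simp add: g2_sub_def)
next
  fix x y assume xy: "x \<in> g2_sub R full" "y \<in> g2_sub R full"
  have "(x + y) 0 + (x + y) 1 = (x 0 + x 1) + (y 0 + y 1)" by simp
  moreover have "full \<or> (x 0 + x 1) + (y 0 + y 1) = 0" using xy by (auto simp: g2_sub_def)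
  ultimately have "full \<or> (x + y) 0 + (x + y) 1 = 0" by (simp only:)
  moreover have "(x + y) n = 0" if "n \<notin> R \<union> {0, 1}" for n
    using xy that by (simp add: g2_sub_def)
  ultimately show "x + y \<in> g2_sub R full" unfolding g2_sub_def by blast
next
  fix c x assume x: "x \<in> g2_sub R full"
  have "seq_scale c x 0 + seq_scale c x 1 = c * (x 0 + x 1)"
    by (simp add: seq_scale_def distrib_left)
  moreover have "full \<or> c * (x 0 + x 1) = 0" using x by (auto simp: g2_sub_def)
  ultimately have "full \<or> seq_scale c x 0 + seq_scale c x 1 = 0" by (simp only:)
  moreover have "seq_scale c x n = 0" if "n \<notin> R \<union> {0, 1}" for n
    using x that by (simp add: g2_sub_def seq_scale_def)
  ultimately show "seq_scale c x \<in> g2_sub R full" unfolding g2_sub_def by blast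
qed

lemma sum_fun_nth: "(\<Sum>i\<in>F. v i) n = (\<Sum>i\<in>F. v i n)" for v :: "'i \<Rightarrow> nat \<Rightarrow> complex"
  by (induction F rule: infinite_finite_induct) simp_all

lemma g2_subD: "x \<in> g2_sub R full \<Longrightarrow> n \<notin> R \<Longrightarrow> 2 \<le> n \<Longrightarrow> x n = 0"
  unfolding g2_sub_def by (elim CollectE conjE allE[of _ n] mp) auto

lemma g2_sub_mono: "R \<subseteq> R' \<Longrightarrow> g2_sub R full \<subseteq> g2_sub R' full"
  unfolding g2_sub_def by blast

definition g2_diag :: "(nat \<Rightarrow> complex) \<Rightarrow> nat \<Rightarrow> complex" where
  "g2_diag x = (\<lambda>n. if n < 2 then x n else 0)"

lemma g2_diag_eq: "g2_diag x = seq_scale (x 0) (g2_unit 0) + seq_scale (x 1) (g2_unit 1)"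
proof
  fix n :: nat
  consider "n = 0" | "n = 1" | "n \<ge> 2" by linarith
  then show "g2_diag x n = (seq_scale (x 0) (g2_unit 0) + seq_scale (x 1) (g2_unit 1)) n"
    by cases (auto simp: g2_diag_def seq_scale_def g2_unit_def)
qed

lemma g2_decompose:
  assumes R: "R \<subseteq> {2..<14}" and x: "x \<in> g2_sub R full"
  shows "x = g2_diag x + (\<Sum>i\<in>R. seq_scale (x i) (g2_unit i))"
proof
  fix n
  have finite_R: "finite R" using R finite_subset by blast
  have R2: "n \<in> R \<Longrightarrow> 2 \<le> n" using R by auto
  have "(\<Sum>i\<in>R. seq_scale (x i) (g2_unit i)) n = (\<Sum>i\<in>R. if n = i then x i else 0)"
    unfolding sum_fun_nth by (rule sum.cong) (auto simp: seq_scale_def g2_unit_def)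
  also have "\<dots> = (if n \<in> R then x n else 0)" using finite_R by simp
  finally have s: "(\<Sum>i\<in>R. seq_scale (x i) (g2_unit i)) n = (if n \<in> R then x n else 0)" .
  have "n \<notin> R \<Longrightarrow> n \<ge> 2 \<Longrightarrow> x n = 0" using x by (rule g2_subD)
  then show "x n = (g2_diag x + (\<Sum>i\<in>R. seq_scale (x i) (g2_unit i))) n"
    unfolding plus_fun_apply s using R2 by (auto simp: g2_diag_def)
qed

text \<open>What makes such a span a simple Lie algebra.  A regular element has distinct nonzero eigenvalues on the root
  vectors, which separates the root spaces.  The last assumption is the form in which the irreducibility of the
  root system enters.\<close>

locale g2_subalgebra =
  fixes R :: "nat set" and full :: bool
  assumes R: "R \<subseteq> {2..<14}" and R_nonempty: "R \<noteq> {}"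
    and closed: "x \<in> g2_sub R full \<Longrightarrow> y \<in> g2_sub R full \<Longrightarrow> g2_bracket x y \<in> g2_sub R full"
    and regular: "\<exists>h\<in>g2_sub {} full. inj_on (g2_weight h) R \<and> 0 \<notin> g2_weight h ` R"
    and separating: "h \<in> g2_sub {} full \<Longrightarrow> (\<And>i. i \<in> R \<Longrightarrow> g2_weight h i = 0) \<Longrightarrow> h = 0"
    and generated: "seq.subspace I \<Longrightarrow> (\<And>x y. x \<in> g2_sub R full \<Longrightarrow> y \<in> I \<Longrightarrow> g2_bracket x y \<in> I)
      \<Longrightarrow> i \<in> R \<Longrightarrow> g2_unit i \<in> I \<Longrightarrow> g2_sub R full \<subseteq> I"

sublocale g2_subalgebra \<subseteq> complex_lie_algebra seq_scale "g2_sub R full" g2_bracket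
proof unfold_locales
  show "seq.subspace (g2_sub R full)" by (rule subspace_g2_sub)
  fix x y z :: "nat \<Rightarrow> complex" and c :: complex
  show "g2_bracket (x + y) z = g2_bracket x z + g2_bracket y z" by (rule g2_bracket_add_left)
  show "g2_bracket x (y + z) = g2_bracket x y + g2_bracket x z"
    using g2_bracket_add_left[of y z x] by (simp add: g2_bracket_antisym[of x])
  show "g2_bracket (seq_scale c x) y = seq_scale c (g2_bracket x y)" by (rule g2_bracket_scale_left)
  show "g2_bracket x (seq_scale c y) = seq_scale c (g2_bracket x y)"
    using g2_bracket_scale_left[of c y x] by (simp add: g2_bracket_antisym[of x])
  show "g2_bracket x x = 0" by (rule g2_bracket_self)
  show "g2_bracket x (g2_bracket y z) + g2_bracket y (g2_bracket z x) + g2_bracket z (g2_bracket x y) = 0"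
    by (rule g2_bracket_jacobi)
qed (rule closed)

context g2_subalgebra
begin

abbreviation "Lg \<equiv> g2_sub R full"
abbreviation "Hg \<equiv> g2_sub {} full"

lemma finite_R: "finite R" using R finite_subset by blast

lemma R_bounds: "i \<in> R \<Longrightarrow> 2 \<le> i" "i \<in> R \<Longrightarrow> i < 14" using R by auto

lemma Hg_subset: "Hg \<subseteq> Lg" by (rule g2_sub_mono) simp

lemma Lg_beyond: "x \<in> Lg \<Longrightarrow> n \<ge> 14 \<Longrightarrow> x n = 0"
  by (rule g2_subD[of x R full]) (use R_bounds(2)[of n] in auto)

lemma Hg_beyond: "h \<in> Hg \<Longrightarrow> n \<ge> 2 \<Longrightarrow> h n = 0"
  by (rule g2_subD[of h "{}" full]) simp_all

lemma unit_in_Lg: "i \<in> R \<Longrightarrow> g2_unit i \<in> Lg"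
  using R_bounds(1)[of i] by (auto simp: g2_sub_def g2_unit_def)

lemma Hg_bracket:
  assumes "h \<in> Hg" "x \<in> Lg"
  shows "g2_bracket h x = (\<lambda>n. g2_weight h n * x n)"
proof (rule g2_weight_bracket)
  show "h n = 0" if "n \<ge> 2" for n using Hg_beyond[OF assms(1) that] .
  show "x n = 0" if "n \<ge> 14" for n using Lg_beyond[OF assms(2) that] .
qed

lemma g2_weight_diag: "g2_weight h 0 = 0" "g2_weight h 1 = 0"
  by (simp_all add: g2_weight_def)

lemma Hg_abelian:
  assumes "h \<in> Hg" "h' \<in> Hg"
  shows "g2_bracket h h' = 0"
proof
  fix n :: nat
  consider "n = 0" | "n = 1" | "n \<ge> 2" by linarith
  then show "g2_bracket h h' n = 0 n"
    unfolding Hg_bracket[OF assms(1) subsetD[OF Hg_subset assms(2)]]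
    by cases (use g2_weight_diag Hg_beyond[OF assms(2)] in auto)
qed

lemma unit_root_space:
  assumes "i \<in> R"
  shows "g2_unit i \<in> root_space Hg (\<lambda>h. g2_weight h i)"
proof -
  have "g2_bracket h (g2_unit i) = seq_scale (g2_weight h i) (g2_unit i)" if "h \<in> Hg" for h
    unfolding Hg_bracket[OF that unit_in_Lg[OF assms]] by (rule ext) (simp add: g2_unit_def seq_scale_def)
  then show ?thesis using unit_in_Lg[OF assms] unfolding root_space_def by blast
qed

lemma unit_nonzero: "g2_unit i \<noteq> 0"
  by (auto simp: g2_unit_def fun_eq_iff)

lemma diag_in_Hg: "x \<in> Lg \<Longrightarrow> g2_diag x \<in> Hg"
  by (auto simp: g2_sub_def g2_diag_def)

lemmas decompose = g2_decompose[OF R]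

lemma regular_element:
  obtains h where "h \<in> Hg" "inj_on (g2_weight h) R" "\<forall>i\<in>R. g2_weight h i \<noteq> 0"
  using regular by (metis imageI)

lemma finite_dim_g2: "finite_dim"
proof -
  let ?B = "insert (g2_unit 0) (insert (g2_unit 1) (g2_unit ` R))"
  have "Lg \<subseteq> span ?B"
  proof
    fix x assume x: "x \<in> Lg"
    have "g2_diag x \<in> span ?B" unfolding g2_diag_eq by (intro span_add span_scale span_base; simp)
    moreover have "(\<Sum>i\<in>R. seq_scale (x i) (g2_unit i)) \<in> span ?B"
      by (intro span_sum span_scale span_base) simp
    ultimately show "x \<in> span ?B" using decompose[OF x] span_add by metis
  qed
  moreover have "finite ?B" using finite_R by simp
  moreover obtain C where C: "C \<subseteq> Lg" "independent C" "Lg \<subseteq> span C" using maximal_independent_subset by blast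
  ultimately have "finite C" using independent_span_bound[of ?B C] by (meson order_trans)
  moreover have "Lg = span C" using C(3) span_minimal[OF C(1) subspace_L] by blast
  ultimately show ?thesis unfolding finite_dim_def by blast
qed

text \<open>An element commuting with the diagonal part commutes with a regular element, so it has no root components.\<close>

lemma cartan_g2: "cartan_subalgebra Hg"
  unfolding cartan_subalgebra_def
proof (intro conjI ballI impI)
  show "subspace Hg" by (rule subspace_g2_sub)
  show "Hg \<subseteq> Lg" by (rule Hg_subset)
  show "g2_bracket h h' = 0" if "h \<in> Hg" "h' \<in> Hg" for h h' using that by (rule Hg_abelian)
next
  fix x assume x: "x \<in> Lg" and central: "\<forall>h\<in>Hg. g2_bracket h x = 0"
  obtain h where h: "h \<in> Hg" "\<forall>i\<in>R. g2_weight h i \<noteq> 0" using regular_element by blast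
  have "g2_bracket h x = 0" using central h(1) by blast
  then have w: "g2_weight h n * x n = 0" for n
    unfolding Hg_bracket[OF h(1) x] by (metis zero_fun_apply)
  have "x n = 0" if "n \<in> R" for n using w[of n] h(2) that by simp
  then show "x \<in> Hg" using x unfolding g2_sub_def by blast
next
  fix h assume h: "h \<in> Hg"
  let ?E = "{x \<in> Lg. \<exists>c. g2_bracket h x = seq_scale c x}"
  have "Lg \<subseteq> span ?E"
  proof
    fix x assume x: "x \<in> Lg"
    have "seq_scale 0 (g2_diag x) = 0" by (auto simp: seq_scale_def)
    then have "g2_diag x \<in> ?E" using Hg_abelian[OF h diag_in_Hg[OF x]] diag_in_Hg[OF x] Hg_subset by force
    moreover have "g2_unit i \<in> ?E" if "i \<in> R" for i
      using unit_root_space[OF that] h by (auto simp: root_space_def)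
    ultimately have "g2_diag x + (\<Sum>i\<in>R. seq_scale (x i) (g2_unit i)) \<in> span ?E"
      by (intro span_add span_sum span_scale span_base)
    then show "x \<in> span ?E" using decompose[OF x] by simp
  qed
  moreover have "span ?E \<subseteq> Lg" by (rule span_minimal) (auto simp: subspace_L)
  ultimately show "ad_diagonalizable h" unfolding ad_diagonalizable_def by (rule subset_antisym)
qed

text \<open>The weight components of a nonzero element of an ideal lie in the ideal.  If one of them is a root component, the
  ideal contains a root vector; otherwise the element is diagonal, some root does not vanish on it, and bracketing
  with it produces a root vector.\<close>

lemma simple_g2: "simple"
  unfolding simple_def
proof (intro conjI allI impI)
  obtain h where h: "h \<in> Hg" "inj_on (g2_weight h) R" "\<forall>i\<in>R. g2_weight h i \<noteq> 0"
    using regular_element by blast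
  obtain i where i: "i \<in> R" using R_nonempty by blast
  have "g2_bracket h (g2_unit i) = seq_scale (g2_weight h i) (g2_unit i)"
    using unit_root_space[OF i] h(1) by (auto simp: root_space_def)
  moreover have "seq_scale (g2_weight h i) (g2_unit i) \<noteq> 0"
    using h(3) i unit_nonzero by (simp add: scale_eq_0_iff)
  ultimately have "g2_bracket h (g2_unit i) \<noteq> 0" by simp
  then show "\<exists>x\<in>Lg. \<exists>y\<in>Lg. g2_bracket x y \<noteq> 0" using h(1) Hg_subset unit_in_Lg[OF i] by blast
  fix I assume I: "ideal I"
  have sI: "subspace I" and IL: "I \<subseteq> Lg" and st: "\<And>x y. x \<in> Lg \<Longrightarrow> y \<in> I \<Longrightarrow> g2_bracket x y \<in> I"
    using I by (auto simp: ideal_def)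
  show "I = {0} \<or> I = Lg"
  proof (cases "I = {0}")
    case False
    then obtain x where x: "x \<in> I" "x \<noteq> 0" using subspace_0[OF sI] by blast
    have xL: "x \<in> Lg" using x IL by blast
    define v where "v i = (if i = 0 then g2_diag x else seq_scale (x i) (g2_unit i))" for i
    have zero: "0 \<notin> R" using R_bounds(1)[of 0] by auto
    have "\<forall>i\<in>insert 0 R. v i \<in> I"
    proof (rule weight_components[where S = Hg and \<beta> = "\<lambda>i h. g2_weight h i"])
      show "(\<Sum>i\<in>insert 0 R. v i) \<in> I"
      proof -
        have "(\<Sum>i\<in>R. v i) = (\<Sum>i\<in>R. seq_scale (x i) (g2_unit i))"
          using zero by (intro sum.cong) (auto simp: v_def)
        then have "(\<Sum>i\<in>insert 0 R. v i) = x"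
          using zero finite_R decompose[OF xL] by (simp add: v_def)
        then show ?thesis using x by simp
      qed
      show "v i \<in> root_space Hg (\<lambda>h. g2_weight h i)" if "i \<in> insert 0 R" for i
      proof (cases "i = 0")
        case True
        have "seq_scale 0 y = 0" for y by (auto simp: seq_scale_def)
        then show ?thesis using True Hg_abelian diag_in_Hg[OF xL] Hg_subset
          by (auto simp: v_def root_space_def g2_weight_diag)
      next
        case False
        then show ?thesis using that unit_root_space
          by (auto simp: v_def intro!: subspace_scale subspace_root_space Hg_subset)
      qed
      show "\<exists>h\<in>Hg. g2_weight h i \<noteq> g2_weight h j" if "i \<in> insert 0 R" "j \<in> insert 0 R" "i \<noteq> j" for i j
        using that h g2_weight_diag(1)[of h] by (metis inj_onD insertE)
    qed (use st Hg_subset sI finite_R in auto)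
    then have comps: "seq_scale (x i) (g2_unit i) \<in> I" if "i \<in> R" for i
      using zero that by (cases "i = 0") (auto simp: v_def)
    have "\<exists>i\<in>R. g2_unit i \<in> I"
    proof (cases "\<exists>i\<in>R. x i \<noteq> 0")
      case True
      then obtain i where i: "i \<in> R" "x i \<noteq> 0" by blast
      have "seq_scale (1 / x i) (seq_scale (x i) (g2_unit i)) \<in> I" using comps[OF i(1)] by (rule subspace_scale[OF sI])
      then show ?thesis using i by auto
    next
      case False
      then have "x \<in> Hg" using xL unfolding g2_sub_def by blast
      with separating[of x] x(2) obtain i where i: "i \<in> R" "g2_weight x i \<noteq> 0" by blast
      have "g2_bracket x (g2_unit i) = seq_scale (g2_weight x i) (g2_unit i)"
        using unit_root_space[OF i(1)] \<open>x \<in> Hg\<close> by (auto simp: root_space_def)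
      then have "seq_scale (- g2_weight x i) (g2_unit i) = g2_bracket (g2_unit i) x"
        using g2_bracket_antisym[of "g2_unit i" x] by simp
      also have "\<dots> \<in> I" using st unit_in_Lg[OF i(1)] x(1) by blast
      finally have "seq_scale (- 1 / g2_weight x i) (seq_scale (- g2_weight x i) (g2_unit i)) \<in> I"
        by (rule subspace_scale[OF sI])
      then show ?thesis using i by auto
    qed
    then obtain i where "i \<in> R" "g2_unit i \<in> I" by blast
    from generated[OF sI st this] IL show ?thesis by blast
  qed simp
qed

text \<open>Comparing one nonzero coordinate \<open>k\<close> of a root vector identifies the root with the weight at \<open>k\<close>.\<close>

lemma root_is_weight:
  assumes "is_root Hg \<beta>"
  obtains k where "k \<in> R" "\<forall>h\<in>Hg. \<beta> h = g2_weight h k"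
proof -
  have "0 \<in> root_space Hg \<beta>" using subspace_0[OF subspace_root_space[OF Hg_subset]] .
  with assms obtain x where x: "x \<in> root_space Hg \<beta>" "x \<noteq> 0" unfolding is_root_def by blast
  from assms obtain h0 where h0: "h0 \<in> Hg" "\<beta> h0 \<noteq> 0" by (auto simp: is_root_def)
  obtain k where k: "x k \<noteq> 0" using x(2) by (auto simp: fun_eq_iff)
  have xL: "x \<in> Lg" using x(1) root_space_subset by blast
  have eq: "\<beta> h = g2_weight h k" if h: "h \<in> Hg" for h
  proof -
    have "(\<lambda>n. g2_weight h n * x n) = seq_scale (\<beta> h) x"
      using root_spaceD(2)[OF x(1) h] Hg_bracket[OF h xL] by simp
    then have "g2_weight h k * x k = \<beta> h * x k" unfolding seq_scale_def by (rule fun_cong)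
    then show ?thesis using k by simp
  qed
  have "k \<noteq> 0" "k \<noteq> 1" using eq[OF h0(1)] h0(2) g2_weight_diag by metis+
  then have "2 \<le> k" by simp
  then have "k \<in> R" using g2_subD[OF xL] k by blast
  with eq show ?thesis using that by blast
qed

text \<open>The simple roots are the weights at the positions \<open>s i\<close>, with the opposite roots at the positions \<open>t i\<close>; the
  vectors at these positions are scaled so that their brackets are the coroots.\<close>

lemma has_cartan_matrix_g2:
  assumes s: "\<And>i. i < n \<Longrightarrow> s i \<in> R" and t: "\<And>i. i < n \<Longrightarrow> t i \<in> R"
    and neg: "\<And>i h. i < n \<Longrightarrow> g2_weight h (t i) = - g2_weight h (s i)"
    and A: "\<And>i j. i < n \<Longrightarrow> j < n \<Longrightarrow>
      g2_weight (g2_bracket (g2_unit (s i)) (g2_unit (t i))) (s j) = of_int (A i j)"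
    and A2: "\<And>i. i < n \<Longrightarrow> A i i = 2"
    and indep: "\<And>c i. (\<And>h. h \<in> Hg \<Longrightarrow> (\<Sum>i<n. c i * g2_weight h (s i)) = 0) \<Longrightarrow> i < n \<Longrightarrow> c i = 0"
    and pos: "\<And>k. k \<in> R \<Longrightarrow> \<exists>c :: nat \<Rightarrow> nat. (\<forall>h. g2_weight h k = (\<Sum>i<n. of_nat (c i) * g2_weight h (s i)))
      \<or> (\<forall>h. g2_weight h k = - (\<Sum>i<n. of_nat (c i) * g2_weight h (s i)))"
  shows "has_cartan_matrix n A"
  unfolding has_cartan_matrix_def
proof (intro exI conjI allI impI)
  let ?\<alpha> = "\<lambda>i h. g2_weight h (s i)"
  let ?h = "\<lambda>i. g2_bracket (g2_unit (s i)) (g2_unit (t i))"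
  show "cartan_subalgebra Hg" by (rule cartan_g2)
  show "is_base Hg n ?\<alpha>"
    unfolding is_base_def
  proof (intro conjI allI impI)
    obtain h where h: "h \<in> Hg" "\<forall>i\<in>R. g2_weight h i \<noteq> 0" using regular_element by blast
    show "is_root Hg (?\<alpha> i)" if "i < n" for i
      unfolding is_root_def using h s[OF that] unit_root_space[OF s[OF that]] unit_nonzero by blast
    show "c i = 0" if "\<forall>h\<in>Hg. (\<Sum>i<n. c i * ?\<alpha> i h) = 0" "i < n" for c i
      by (rule indep[of c i]) (use that in blast)+
    fix \<beta> assume "is_root Hg \<beta>"
    then obtain k where k: "k \<in> R" "\<forall>h\<in>Hg. \<beta> h = g2_weight h k" using root_is_weight by blast
    from pos[OF k(1)] obtain c :: "nat \<Rightarrow> nat" where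
      c: "(\<forall>h. g2_weight h k = (\<Sum>i<n. of_nat (c i) * g2_weight h (s i)))
        \<or> (\<forall>h. g2_weight h k = - (\<Sum>i<n. of_nat (c i) * g2_weight h (s i)))" by blast
    show "\<exists>c. (\<forall>h\<in>Hg. \<beta> h = (\<Sum>i<n. of_nat (c i) * ?\<alpha> i h)) \<or>
        (\<forall>h\<in>Hg. \<beta> h = - (\<Sum>i<n. of_nat (c i) * ?\<alpha> i h))"
      using c k(2) by (intro exI[of _ c]) metis
  qed
  show A': "?\<alpha> j (?h i) = of_int (A i j)" if "i < n" "j < n" for i j using that by (rule A)
  show "is_coroot Hg (?\<alpha> i) (?h i)" if "i < n" for i
    unfolding is_coroot_def
  proof (intro conjI bexI)
    show "g2_unit (s i) \<in> root_space Hg (?\<alpha> i)" using s[OF that] by (rule unit_root_space)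
    show "g2_unit (t i) \<in> root_space Hg (\<lambda>k. - ?\<alpha> i k)"
      using unit_root_space[OF t[OF that]] neg[OF that] by simp
    show "?\<alpha> i (?h i) = 2" using A[OF that that] A2[OF that] by simp
  qed simp
qed

end

section \<open>Simple Lie algebras of types A1, A2 and G2\<close>

lemma ideal_step:
  assumes "seq.subspace I" "\<And>y. y \<in> I \<Longrightarrow> g2_bracket x y \<in> I"
    and "g2_bracket x u = seq_scale c w" "c \<noteq> 0" "u \<in> I"
  shows "w \<in> I"
proof -
  have "seq_scale c w \<in> I" using assms(2)[OF assms(5)] assms(3) by simp
  then have "seq_scale (1 / c) (seq_scale c w) \<in> I" by (rule seq.subspace_scale[OF assms(1)])
  then show ?thesis using assms(4) by simp
qed

text \<open>Consecutive roots of the A2 hexagon differ by a root, so the root vectors are connected in a cycle by brackets.\<close>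

lemma g2_unit_brackets_long:
  "g2_bracket (g2_unit 4) (g2_unit 2) = seq_scale (-1) (g2_unit 3)"
  "g2_bracket (g2_unit 5) (g2_unit 3) = seq_scale 1 (g2_unit 4)"
  "g2_bracket (g2_unit 6) (g2_unit 4) = seq_scale (-1) (g2_unit 5)"
  "g2_bracket (g2_unit 7) (g2_unit 5) = seq_scale 1 (g2_unit 6)"
  "g2_bracket (g2_unit 2) (g2_unit 6) = seq_scale (-1) (g2_unit 7)"
  "g2_bracket (g2_unit 3) (g2_unit 7) = seq_scale 1 (g2_unit 2)"
  by (rule g2_ext; simp add: g2_bracket_coords g2_bracket_beyond g2_unit_def seq_scale_def del: One_nat_def)+

text \<open>A cycle through the twelve roots of G2, long and short roots alternating.\<close>

lemma g2_unit_brackets_short: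
  "g2_bracket (g2_unit 9) (g2_unit 2) = seq_scale (-1) (g2_unit 8)"
  "g2_bracket (g2_unit 13) (g2_unit 8) = seq_scale (-3) (g2_unit 3)"
  "g2_bracket (g2_unit 11) (g2_unit 3) = seq_scale 1 (g2_unit 13)"
  "g2_bracket (g2_unit 9) (g2_unit 13) = seq_scale 3 (g2_unit 4)"
  "g2_bracket (g2_unit 10) (g2_unit 4) = seq_scale (-1) (g2_unit 9)"
  "g2_bracket (g2_unit 11) (g2_unit 9) = seq_scale (-3) (g2_unit 5)"
  "g2_bracket (g2_unit 12) (g2_unit 5) = seq_scale 1 (g2_unit 11)"
  "g2_bracket (g2_unit 10) (g2_unit 11) = seq_scale 3 (g2_unit 6)"
  "g2_bracket (g2_unit 8) (g2_unit 6) = seq_scale (-1) (g2_unit 10)"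
  "g2_bracket (g2_unit 12) (g2_unit 10) = seq_scale (-3) (g2_unit 7)"
  "g2_bracket (g2_unit 13) (g2_unit 7) = seq_scale 1 (g2_unit 12)"
  "g2_bracket (g2_unit 8) (g2_unit 12) = seq_scale 3 (g2_unit 2)"
  by (rule g2_ext; simp add: g2_bracket_coords g2_bracket_beyond g2_unit_def seq_scale_def del: One_nat_def)+

lemma g2_unit_brackets_diag:
  "g2_bracket (g2_unit 3) (g2_unit 6) = seq_scale 1 (g2_unit 0)"
  "g2_bracket (g2_unit 4) (g2_unit 7) = seq_scale 1 (g2_unit 1)"
  "g2_bracket (g2_unit 2) (g2_unit 5) = g2_unit 0 - g2_unit 1"
  "g2_bracket (g2_unit 5) (g2_unit 2) = seq_scale (-1) (g2_unit 0 - g2_unit 1)"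
  "g2_bracket (g2_unit 5) (g2_unit 0 - g2_unit 1) = seq_scale 2 (g2_unit 5)"
  "g2_bracket (g2_unit 2) (g2_unit 0 - g2_unit 1) = seq_scale (-2) (g2_unit 2)"
  by (rule g2_ext; simp add: g2_bracket_coords g2_bracket_beyond g2_unit_def seq_scale_def del: One_nat_def)+

lemma g2_sub_spanned:
  assumes I: "seq.subspace I" and R: "R \<subseteq> {2..<14}" and x: "x \<in> g2_sub R full"
    and "g2_diag x \<in> I" "\<forall>i\<in>R. g2_unit i \<in> I"
  shows "x \<in> I"
proof -
  have "g2_diag x + (\<Sum>i\<in>R. seq_scale (x i) (g2_unit i)) \<in> I"
    using assms by (intro seq.subspace_add seq.subspace_sum seq.subspace_scale) auto
  then show ?thesis using g2_decompose[OF R x] by simp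
qed

abbreviation "R_G2 \<equiv> {2, 3, 4, 5, 6, 7, 8, 9, 10, 11, 12, 13 :: nat}"
abbreviation "R_A2 \<equiv> {2, 3, 4, 5, 6, 7 :: nat}"
abbreviation "R_A1 \<equiv> {2, 5 :: nat}"

lemma g2_unit_mem: "i \<in> R \<Longrightarrow> 2 \<le> i \<Longrightarrow> g2_unit i \<in> g2_sub R full"
  by (auto simp: g2_sub_def g2_unit_def)

lemma g2_sub_closedI:
  assumes "R \<subseteq> {2..<14}" "\<And>n. n \<notin> R \<Longrightarrow> 2 \<le> n \<Longrightarrow> n < 14 \<Longrightarrow> z n = 0"
    "full \<or> z 0 + z 1 = 0" "\<And>n. n \<ge> 14 \<Longrightarrow> z n = 0"
  shows "z \<in> g2_sub R full"
proof -
  have "z n = 0" if "n \<notin> R \<union> {0, 1}" for n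
  proof (cases "n < 14")
    case True
    have "2 \<le> n" using that by auto
    then show ?thesis using assms(2)[of n] that True by blast
  qed (use assms(4) in simp)
  then show ?thesis using assms(3) unfolding g2_sub_def by blast
qed

text \<open>The diagonal matrix \<open>diag(1, 5, -6)\<close>, on which the twelve roots of G2 take distinct nonzero values.\<close>

definition h_reg :: "nat \<Rightarrow> complex" where
  "h_reg n = (if n = 0 then 1 else if n = 1 then 5 else 0)"

lemma full_separating:
  assumes "h \<in> g2_sub {} True" "g2_weight h 2 = 0" "g2_weight h 3 = 0"
  shows "h = 0"
proof -
  have 1: "h 0 = h 1" "2 * h 0 + h 1 = 0" using assms(2,3) by (simp_all add: g2_weight_def)
  have "3 * h 0 = 2 * h 0 + h 1" unfolding 1(1)[symmetric] by simp
  then have 0: "h 0 = 0" "h 1 = 0" using 1 by simp_all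
  show ?thesis
  proof
    fix n :: nat
    consider "n = 0" | "n = 1" | "n \<ge> 2" by linarith
    then show "h n = 0 n"
    proof cases
      case 3
      then show ?thesis using g2_subD[OF assms(1)] by simp
    qed (simp_all only: 0 zero_fun_apply)
  qed
qed

interpretation G2: g2_subalgebra R_G2 True
proof
  show "R_G2 \<subseteq> {2..<14}" by simp
  show "R_G2 \<noteq> {}" by simp
  show "g2_bracket x y \<in> g2_sub R_G2 True" for x y
  proof (rule g2_sub_closedI)
    show "g2_bracket x y n = 0" if "n \<notin> R_G2" "2 \<le> n" "n < 14" for n
      using less_14_cases[OF that(3)] that(1,2) unfolding insert_iff empty_iff by (elim disjE FalseE) simp_all
  qed (simp_all add: g2_bracket_beyond)
  show "\<exists>h\<in>g2_sub {} True. inj_on (g2_weight h) R_G2 \<and> 0 \<notin> g2_weight h ` R_G2"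
  proof (intro bexI[of _ h_reg] conjI)
    show "h_reg \<in> g2_sub {} True" by (simp add: g2_sub_def h_reg_def)
  qed (simp_all add: g2_weight_def h_reg_def)
  show "h = 0" if "h \<in> g2_sub {} True" "\<And>i. i \<in> R_G2 \<Longrightarrow> g2_weight h i = 0" for h
    by (rule full_separating[OF that(1)]) (rule that(2), simp)+
  fix I i
  assume I: "seq.subspace I" and st: "\<And>x y. x \<in> g2_sub R_G2 True \<Longrightarrow> y \<in> I \<Longrightarrow> g2_bracket x y \<in> I"
    and i: "i \<in> R_G2" "g2_unit i \<in> I"
  have mem: "g2_unit k \<in> g2_sub R_G2 True" if "k \<in> R_G2" for k using that by (rule g2_unit_mem) (use that in auto)
  have step: "g2_unit j \<in> I" if "g2_bracket (g2_unit k) (g2_unit l) = seq_scale c (g2_unit j)" "c \<noteq> 0"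
      "k \<in> R_G2" "g2_unit l \<in> I" for j k l c
    by (rule ideal_step[OF I st[OF mem[OF that(3)]] that(1,2,4)])
  \<comment> \<open>The implications run once around the cycle of root vectors, so one of them in \<open>I\<close> puts all of them into \<open>I\<close>.\<close>
  define P where "P k \<longleftrightarrow> g2_unit k \<in> I" for k
  note s = step[folded P_def, OF g2_unit_brackets_short(1)] step[folded P_def, OF g2_unit_brackets_short(2)]
    step[folded P_def, OF g2_unit_brackets_short(3)] step[folded P_def, OF g2_unit_brackets_short(4)]
    step[folded P_def, OF g2_unit_brackets_short(5)] step[folded P_def, OF g2_unit_brackets_short(6)]
    step[folded P_def, OF g2_unit_brackets_short(7)] step[folded P_def, OF g2_unit_brackets_short(8)]
    step[folded P_def, OF g2_unit_brackets_short(9)] step[folded P_def, OF g2_unit_brackets_short(10)]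
    step[folded P_def, OF g2_unit_brackets_short(11)] step[folded P_def, OF g2_unit_brackets_short(12)]
  have imp: "P 2 \<longrightarrow> P 8" "P 8 \<longrightarrow> P 3" "P 3 \<longrightarrow> P 13" "P 13 \<longrightarrow> P 4" "P 4 \<longrightarrow> P 9" "P 9 \<longrightarrow> P 5"
    "P 5 \<longrightarrow> P 11" "P 11 \<longrightarrow> P 6" "P 6 \<longrightarrow> P 10" "P 10 \<longrightarrow> P 7" "P 7 \<longrightarrow> P 12" "P 12 \<longrightarrow> P 2"
    by (rule impI, rule s, simp, simp, assumption)+
  have "P 2 \<or> P 3 \<or> P 4 \<or> P 5 \<or> P 6 \<or> P 7 \<or> P 8 \<or> P 9 \<or> P 10 \<or> P 11 \<or> P 12 \<or> P 13"
    using i unfolding P_def insert_iff empty_iff by (elim disjE FalseE) simp_all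
  with imp have "P 2 \<and> P 3 \<and> P 4 \<and> P 5 \<and> P 6 \<and> P 7 \<and> P 8 \<and> P 9 \<and> P 10 \<and> P 11 \<and> P 12 \<and> P 13"
    by argo
  then have units: "\<forall>k\<in>R_G2. g2_unit k \<in> I" by (simp add: P_def)
  have "g2_unit 0 \<in> I" "g2_unit 1 \<in> I"
    using ideal_step[OF I st[OF mem] g2_unit_brackets_diag(1)] ideal_step[OF I st[OF mem] g2_unit_brackets_diag(2)]
      units by simp_all
  then have "g2_diag x \<in> I" for x
    unfolding g2_diag_eq using I by (intro seq.subspace_add seq.subspace_scale)
  then show "g2_sub R_G2 True \<subseteq> I" using g2_sub_spanned[OF I _ _ _ units] by auto
qed

text \<open>The six long roots are those of the summand sl(3).\<close>

interpretation A2: g2_subalgebra R_A2 True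
proof
  show "R_A2 \<subseteq> {2..<14}" by simp
  show "R_A2 \<noteq> {}" by simp
  show "g2_bracket x y \<in> g2_sub R_A2 True" if xy: "x \<in> g2_sub R_A2 True" "y \<in> g2_sub R_A2 True" for x y
  proof (rule g2_sub_closedI)
    have z: "z 8 = 0" "z 9 = 0" "z 10 = 0" "z 11 = 0" "z 12 = 0" "z 13 = 0" if "z \<in> g2_sub R_A2 True" for z
      using that by (rule g2_subD; simp)+
    show "g2_bracket x y n = 0" if "n \<notin> R_A2" "2 \<le> n" "n < 14" for n
      using less_14_cases[OF that(3)] that(1,2) unfolding insert_iff empty_iff
      by (elim disjE FalseE) (simp_all add: g2_bracket_coords z[OF xy(1)] z[OF xy(2)])
  qed (simp_all add: g2_bracket_beyond)
  show "\<exists>h\<in>g2_sub {} True. inj_on (g2_weight h) R_A2 \<and> 0 \<notin> g2_weight h ` R_A2"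
  proof (intro bexI[of _ h_reg] conjI)
    show "h_reg \<in> g2_sub {} True" by (simp add: g2_sub_def h_reg_def)
  qed (simp_all add: g2_weight_def h_reg_def)
  show "h = 0" if "h \<in> g2_sub {} True" "\<And>i. i \<in> R_A2 \<Longrightarrow> g2_weight h i = 0" for h
    by (rule full_separating[OF that(1)]) (rule that(2), simp)+
  fix I i
  assume I: "seq.subspace I" and st: "\<And>x y. x \<in> g2_sub R_A2 True \<Longrightarrow> y \<in> I \<Longrightarrow> g2_bracket x y \<in> I"
    and i: "i \<in> R_A2" "g2_unit i \<in> I"
  have mem: "g2_unit k \<in> g2_sub R_A2 True" if "k \<in> R_A2" for k using that by (rule g2_unit_mem) (use that in auto)
  have step: "g2_unit j \<in> I" if "g2_bracket (g2_unit k) (g2_unit l) = seq_scale c (g2_unit j)" "c \<noteq> 0"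
      "k \<in> R_A2" "g2_unit l \<in> I" for j k l c
    by (rule ideal_step[OF I st[OF mem[OF that(3)]] that(1,2,4)])
  \<comment> \<open>The implications run once around the cycle of root vectors, so one of them in \<open>I\<close> puts all of them into \<open>I\<close>.\<close>
  define P where "P k \<longleftrightarrow> g2_unit k \<in> I" for k
  note s = step[folded P_def, OF g2_unit_brackets_long(1)] step[folded P_def, OF g2_unit_brackets_long(2)]
    step[folded P_def, OF g2_unit_brackets_long(3)] step[folded P_def, OF g2_unit_brackets_long(4)]
    step[folded P_def, OF g2_unit_brackets_long(5)] step[folded P_def, OF g2_unit_brackets_long(6)]
  have imp: "P 2 \<longrightarrow> P 3" "P 3 \<longrightarrow> P 4" "P 4 \<longrightarrow> P 5" "P 5 \<longrightarrow> P 6" "P 6 \<longrightarrow> P 7" "P 7 \<longrightarrow> P 2"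
    by (rule impI, rule s, simp, simp, assumption)+
  have "P 2 \<or> P 3 \<or> P 4 \<or> P 5 \<or> P 6 \<or> P 7"
    using i unfolding P_def insert_iff empty_iff by (elim disjE FalseE) simp_all
  with imp have "P 2 \<and> P 3 \<and> P 4 \<and> P 5 \<and> P 6 \<and> P 7" by argo
  then have units: "\<forall>k\<in>R_A2. g2_unit k \<in> I" by (simp add: P_def)
  have "g2_unit 0 \<in> I" "g2_unit 1 \<in> I"
    using ideal_step[OF I st[OF mem] g2_unit_brackets_diag(1)] ideal_step[OF I st[OF mem] g2_unit_brackets_diag(2)]
      units by simp_all
  then have "g2_diag x \<in> I" for x
    unfolding g2_diag_eq using I by (intro seq.subspace_add seq.subspace_scale)
  then show "g2_sub R_A2 True \<subseteq> I" using g2_sub_spanned[OF I _ _ _ units] by auto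
qed

lemma A1_diag_eq:
  assumes "x \<in> g2_sub R False"
  shows "g2_diag x = seq_scale (x 0) (g2_unit 0 - g2_unit 1)"
proof -
  have "x 0 + x 1 = 0" using assms unfolding g2_sub_def by blast
  then have "x 1 = - x 0" by (simp add: add_eq_0_iff)
  then show ?thesis unfolding g2_diag_eq by (simp add: seq.scale_right_diff_distrib)
qed

text \<open>With a single pair of opposite roots, the ideal passes from one root vector to the other through their bracket
  \<open>diag(1, -1, 0)\<close>.\<close>

interpretation A1: g2_subalgebra R_A1 False
proof
  show "R_A1 \<subseteq> {2..<14}" by simp
  show "R_A1 \<noteq> {}" by simp
  show "g2_bracket x y \<in> g2_sub R_A1 False" if xy: "x \<in> g2_sub R_A1 False" "y \<in> g2_sub R_A1 False" for x y
  proof (rule g2_sub_closedI)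
    have z: "z 3 = 0" "z 4 = 0" "z 6 = 0" "z 7 = 0"
      "z 8 = 0" "z 9 = 0" "z 10 = 0" "z 11 = 0" "z 12 = 0" "z 13 = 0" if "z \<in> g2_sub R_A1 False" for z
      using that by (rule g2_subD; simp)+
    show "g2_bracket x y n = 0" if "n \<notin> R_A1" "2 \<le> n" "n < 14" for n
      using less_14_cases[OF that(3)] that(1,2) unfolding insert_iff empty_iff
      by (elim disjE FalseE) (simp_all add: g2_bracket_coords z[OF xy(1)] z[OF xy(2)])
    show "False \<or> g2_bracket x y 0 + g2_bracket x y 1 = 0"
      unfolding g2_bracket_coords z[OF xy(1)] z[OF xy(2)] by simp
  qed (simp_all add: g2_bracket_beyond)
  define h :: "nat \<Rightarrow> complex" where "h = g2_unit 0 - g2_unit 1"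
  show "\<exists>h\<in>g2_sub {} False. inj_on (g2_weight h) R_A1 \<and> 0 \<notin> g2_weight h ` R_A1"
  proof (intro bexI[of _ h] conjI)
    show "h \<in> g2_sub {} False" by (simp add: g2_sub_def h_def g2_unit_def)
  qed (simp_all add: g2_weight_def h_def g2_unit_def)
  show "h = 0" if h: "h \<in> g2_sub {} False" and w: "\<And>i. i \<in> R_A1 \<Longrightarrow> g2_weight h i = 0" for h
  proof -
    have "h 0 + h 1 = 0" using h unfolding g2_sub_def by blast
    moreover have "h 0 = h 1" using w[of 2] by (simp add: g2_weight_def)
    ultimately have "h 0 = 0" by simp
    then have "g2_diag h = 0" unfolding A1_diag_eq[OF h] by simp
    then show ?thesis using g2_decompose[OF _ h] by simp
  qed
  fix I i
  assume I: "seq.subspace I" and st: "\<And>x y. x \<in> g2_sub R_A1 False \<Longrightarrow> y \<in> I \<Longrightarrow> g2_bracket x y \<in> I"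
    and i: "i \<in> R_A1" "g2_unit i \<in> I"
  let ?h = "g2_unit 0 - g2_unit 1"
  have mem: "g2_unit k \<in> g2_sub R_A1 False" if "k \<in> R_A1" for k using that by (rule g2_unit_mem) (use that in auto)
  have step: "w \<in> I" if "g2_bracket (g2_unit k) u = seq_scale c w" "c \<noteq> 0" "k \<in> R_A1" "u \<in> I" for k u w c
    by (rule ideal_step[OF I st[OF mem[OF that(3)]] that(1,2,4)])
  have "g2_bracket (g2_unit 2) (g2_unit 5) = seq_scale 1 ?h" by (simp add: g2_unit_brackets_diag(3))
  then have h: "?h \<in> I"
    using i step[OF g2_unit_brackets_diag(4)] step[of 2 "g2_unit 5" 1 ?h] by auto
  then have units: "\<forall>k\<in>R_A1. g2_unit k \<in> I"
    using step[OF g2_unit_brackets_diag(5)] step[OF g2_unit_brackets_diag(6)] by simp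
  have "g2_diag x \<in> I" if "x \<in> g2_sub R_A1 False" for x
    unfolding A1_diag_eq[OF that] using I h by (intro seq.subspace_scale)
  then show "g2_sub R_A1 False \<subseteq> I" using g2_sub_spanned[OF I _ _ _ units] by auto
qed

lemma g2_sub_empty_unit: "g2_unit 0 \<in> g2_sub {} True" "g2_unit 1 \<in> g2_sub {} True"
  "g2_unit 0 - g2_unit 1 \<in> g2_sub {} False"
  by (auto simp: g2_sub_def g2_unit_def)

lemma sum_lessThan_2: "(\<Sum>i<2. f i) = f 0 + f (1 :: nat)" for f :: "nat \<Rightarrow> complex"
  by (simp add: eval_nat_numeral)

lemma less_2: "i < 2 \<Longrightarrow> i = 0 \<or> i = (1 :: nat)" by linarith

lemma exists_A1: "simple_lie_algebra_of_type (Type_A 1) seq_scale (g2_sub R_A1 False) g2_bracket"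
proof -
  have "A1.has_cartan_matrix 1 (cartan_matrix (Type_A 1))"
  proof (rule A1.has_cartan_matrix_g2[where s = "\<lambda>_. 2" and t = "\<lambda>_. 5"])
    show "c i = 0" if "\<And>h. h \<in> g2_sub {} False \<Longrightarrow> (\<Sum>i<1. c i * g2_weight h 2) = 0" "i < 1" for c :: "nat \<Rightarrow> complex" and i
      using that(1)[OF g2_sub_empty_unit(3)] that(2) by (simp add: g2_weight_def g2_unit_def)
    show "\<exists>c :: nat \<Rightarrow> nat. (\<forall>h. g2_weight h k = (\<Sum>i<1. of_nat (c i) * g2_weight h 2))
        \<or> (\<forall>h. g2_weight h k = - (\<Sum>i<1. of_nat (c i) * g2_weight h 2))" if "k \<in> R_A1" for k
      using that by (intro exI[of _ "\<lambda>_. 1"]) (auto simp: g2_weight_def)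
  qed (simp_all add: g2_bracket_coords g2_weight_def g2_unit_def del: One_nat_def)
  then show ?thesis
    unfolding simple_lie_algebra_of_type_def dynkin_rank.simps
    using A1.complex_lie_algebra_axioms A1.finite_dim_g2 A1.simple_g2 by blast
qed

text \<open>The simple roots are \<open>t\<^sub>1 - t\<^sub>2\<close> and \<open>t\<^sub>2 - t\<^sub>3\<close>, at the positions 2 and 4, where \<open>t\<^sub>i\<close> are the diagonal entries.\<close>

lemma exists_A2: "simple_lie_algebra_of_type (Type_A 2) seq_scale (g2_sub R_A2 True) g2_bracket"
proof -
  have "A2.has_cartan_matrix 2 (cartan_matrix (Type_A 2))"
  proof (rule A2.has_cartan_matrix_g2[where s = "\<lambda>i. if i = 0 then 2 else 4" and t = "\<lambda>i. if i = 0 then 5 else 7"])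
    show "c i = 0" if c: "\<And>h. h \<in> g2_sub {} True \<Longrightarrow> (\<Sum>i<2. c i * g2_weight h (if i = 0 then 2 else 4)) = 0" "i < 2"
      for c :: "nat \<Rightarrow> complex" and i
    proof -
      have "c 0 + c 1 = 0" "c 1 * 2 = c 0"
        using c(1)[OF g2_sub_empty_unit(1)] c(1)[OF g2_sub_empty_unit(2)]
        by (simp_all add: sum_lessThan_2 g2_weight_def g2_unit_def)
      then have "3 * c 1 = 0" "c 0 = 2 * c 1" by algebra+
      then show ?thesis using less_2[OF c(2)] by auto
    qed
    fix k :: nat assume k: "k \<in> R_A2"
    \<comment> \<open>The absolute values of the two coefficients of the root at position \<open>k\<close>.\<close>
    define a :: "nat \<Rightarrow> nat" where "a = (\<lambda>k. if k = 4 \<or> k = 7 then 0 else 1)"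
    define b :: "nat \<Rightarrow> nat" where "b = (\<lambda>k. if k = 2 \<or> k = 5 then 0 else 1)"
    show "\<exists>c :: nat \<Rightarrow> nat. (\<forall>h. g2_weight h k = (\<Sum>i<2. of_nat (c i) * g2_weight h (if i = 0 then 2 else 4)))
        \<or> (\<forall>h. g2_weight h k = - (\<Sum>i<2. of_nat (c i) * g2_weight h (if i = 0 then 2 else 4)))"
      using k unfolding insert_iff empty_iff sum_lessThan_2
      by (intro exI[of _ "\<lambda>i. if i = 0 then a k else b k"], elim disjE FalseE)
         (simp_all add: a_def b_def g2_weight_def algebra_simps)
  next
    show "g2_weight (g2_bracket (g2_unit (if i = 0 then 2 else 4)) (g2_unit (if i = 0 then 5 else 7))) (if j = 0 then 2 else 4)
        = of_int (cartan_matrix (Type_A 2) i j)" if "i < 2" "j < 2" for i j :: nat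
      using less_2[OF that(1)] less_2[OF that(2)]
      by (elim disjE) (simp_all add: g2_bracket_coords g2_weight_def g2_unit_def del: One_nat_def)
  qed (auto simp: g2_weight_def)
  then show ?thesis
    unfolding simple_lie_algebra_of_type_def dynkin_rank.simps
    using A2.complex_lie_algebra_axioms A2.finite_dim_g2 A2.simple_g2 by blast
qed

text \<open>The simple roots are the long root \<open>t\<^sub>1 - t\<^sub>2\<close> at position 2 and the short root \<open>t\<^sub>2\<close> at position 9, where \<open>t\<^sub>i\<close> are
  the diagonal entries; the coroots are \<open>diag(1, -1, 0)\<close> and \<open>diag(-1, 2, -1)\<close>.\<close>

lemma exists_G2: "simple_lie_algebra_of_type Type_G2 seq_scale (g2_sub R_G2 True) g2_bracket"
proof -
  have "G2.has_cartan_matrix 2 (cartan_matrix Type_G2)"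
  proof (rule G2.has_cartan_matrix_g2[where s = "\<lambda>i. if i = 0 then 2 else 9" and t = "\<lambda>i. if i = 0 then 5 else 12"])
    show "c i = 0" if c: "\<And>h. h \<in> g2_sub {} True \<Longrightarrow> (\<Sum>i<2. c i * g2_weight h (if i = 0 then 2 else 9)) = 0" "i < 2"
      for c :: "nat \<Rightarrow> complex" and i
    proof -
      have "c 0 = 0" "c 1 = c 0"
        using c(1)[OF g2_sub_empty_unit(1)] c(1)[OF g2_sub_empty_unit(2)]
        by (simp_all add: sum_lessThan_2 g2_weight_def g2_unit_def)
      then show ?thesis using less_2[OF c(2)] by auto
    qed
    fix k :: nat assume k: "k \<in> R_G2"
    \<comment> \<open>The absolute values of the two coefficients of the root at position \<open>k\<close>; the entries at 0 and 1 are fillers.\<close>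
    define a :: "nat \<Rightarrow> nat" where "a = (\<lambda>k. [0, 0, 1, 2, 1, 1, 2, 1, 1, 0, 1, 1, 0, 1] ! k)"
    define b :: "nat \<Rightarrow> nat" where "b = (\<lambda>k. [0, 0, 0, 3, 3, 0, 3, 3, 1, 1, 2, 1, 1, 2] ! k)"
    show "\<exists>c :: nat \<Rightarrow> nat. (\<forall>h. g2_weight h k = (\<Sum>i<2. of_nat (c i) * g2_weight h (if i = 0 then 2 else 9)))
        \<or> (\<forall>h. g2_weight h k = - (\<Sum>i<2. of_nat (c i) * g2_weight h (if i = 0 then 2 else 9)))"
      using k unfolding insert_iff empty_iff sum_lessThan_2
      by (intro exI[of _ "\<lambda>i. if i = 0 then a k else b k"], elim disjE FalseE)
         (simp_all add: a_def b_def g2_weight_def algebra_simps)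
  next
    show "g2_weight (g2_bracket (g2_unit (if i = 0 then 2 else 9)) (g2_unit (if i = 0 then 5 else 12))) (if j = 0 then 2 else 9)
        = of_int (cartan_matrix Type_G2 i j)" if "i < 2" "j < 2" for i j :: nat
      using less_2[OF that(1)] less_2[OF that(2)]
      by (elim disjE) (simp_all add: g2_bracket_coords g2_weight_def g2_unit_def del: One_nat_def)
  qed (auto simp: g2_weight_def)
  then show ?thesis
    unfolding simple_lie_algebra_of_type_def dynkin_rank.simps
    using G2.complex_lie_algebra_axioms G2.finite_dim_g2 G2.simple_g2 by blast
qed

section \<open>The polynomials and the dimensions\<close>

theorem theorem0p13:
  shows "\<exists>r4 r3 r2 :: nat.
    (\<forall>s. euler_coeff 4 s = 1 / fact 4 * s * (s - 1) * (s - 3) * (s - of_nat r4))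
    \<and> (\<forall>s. - euler_coeff 3 s = 1 / fact 3 * s * (s - 1) * (s - of_nat r3))
    \<and> (\<forall>s. euler_coeff 2 s = 1 / fact 2 * s * (s - of_nat r2))
    \<and> (\<exists>L br. simple_lie_algebra_of_type Type_G2 seq_scale L br)
    \<and> (\<forall>(sc :: complex \<Rightarrow> 'a::ab_group_add \<Rightarrow> 'a) L br.
          simple_lie_algebra_of_type Type_G2 sc L br \<longrightarrow> vector_space.dim sc L = r4)
    \<and> (\<exists>L br. simple_lie_algebra_of_type (Type_A 2) seq_scale L br)
    \<and> (\<forall>(sc :: complex \<Rightarrow> 'a \<Rightarrow> 'a) L br.
          simple_lie_algebra_of_type (Type_A 2) sc L br \<longrightarrow> vector_space.dim sc L = r3)
    \<and> (\<exists>L br. simple_lie_algebra_of_type (Type_A 1) seq_scale L br)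
    \<and> (\<forall>(sc :: complex \<Rightarrow> 'a \<Rightarrow> 'a) L br.
          simple_lie_algebra_of_type (Type_A 1) sc L br \<longrightarrow> vector_space.dim sc L = r2)
    \<and> r4 = 14 \<and> r3 = 8 \<and> r2 = 3
    \<and> (\<forall>s. euler_coeff 4 s = 1 / fact 4 * s * (s - 1) * (s - 3) * (s - 14))
    \<and> (\<forall>s. - euler_coeff 3 s = 1 / fact 3 * s * (s - 1) * (s - 8))
    \<and> (\<forall>s. euler_coeff 2 s = 1 / fact 2 * s * (s - 3))"
proof (rule exI[of _ 14], rule exI[of _ 8], rule exI[of _ 3], intro conjI allI impI)
  show "\<exists>L br. simple_lie_algebra_of_type Type_G2 seq_scale L br"
    using exists_G2 by blast
  show "\<exists>L br. simple_lie_algebra_of_type (Type_A 2) seq_scale L br"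
    using exists_A2 by blast
  show "\<exists>L br. simple_lie_algebra_of_type (Type_A 1) seq_scale L br"
    using exists_A1 by blast
qed (simp_all only: euler_coeff_values of_nat_numeral dim_type_A1 dim_type_A2 dim_type_G2)

end
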